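(* For each $\kappa\in(0,\infty)$ and each integer $n\ge2$, the expected Mixup loss $w\mapsto\mathbb{E}_\kappa[\mathcal{L}_S^{\mathrm{mix}}(w)]$ has a unique minimizer $w^*_{\mathrm{mix}}(n,\kappa)$ over $\mathbb{R}^d$. In addition, its direction is the same as that of the Bayes optimal solution $\Sigma^{-1}\mu$, i.e. $w^*_{\mathrm{mix}}(n,\kappa)=c\,\Sigma^{-1}\mu$ for some $c>0$.
   Context: Fix $d\ge 1$, a nonzero vector $\mu\in\mathbb{R}^d$ and a (symmetric) positive definite matrix $\Sigma\in\mathbb{R}^{d\times d}$ with $\|\mu\|^2=\|\Sigma\|$ ($\ell_2$ norm for vectors, spectral norm for matrices). For $\kappa\in(0,\infty)$, $\mathcal{D}_\kappa$ is the distribution of $(x,y)\in\mathbb{R}^d\times\{0,1\}$ with $y$ uniform on $\{0,1\}$, $x\mid y=1\sim N(\mu,\kappa^{-1}\Sigma)$ and $x\mid y=0\sim N(-\mu,\kappa^{-1}\Sigma)$. The training set is $S=\{(x_i,y_i)\}_{i=1}^n$, drawn i.i.d. from $\mathcal{D}_\kappa$, $n\ge 2$. Let $l(z)=\log(1+e^{-z})$. Mixup: $\Lambda$ is a probability distribution with support contained in $[0,1]$ and $g:[0,1]\to[0,1]$ is a function such that $g(z)>\frac12$ if and only if $z>\frac12$, and $\mathbb{P}_{\lambda\sim\Lambda}[\lambda\notin\{0,1\}\text{ and }g(\lambda)\ne\frac12]>0$. Let $\lambda_{i,j}$ ($1\le i,j\le n$) be i.i.d. from $\Lambda$, independent of $S$,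 and $$\tilde x_{i,j}=g(\lambda_{i,j})x_i+(1-g(\lambda_{i,j}))x_j,\qquad \tilde y_{i,j}=\lambda_{i,j}y_i+(1-\lambda_{i,j})y_j.$$ The Mixup loss is $$\mathcal{L}_S^{\mathrm{mix}}(w)=\frac1{n^2}\sum_{i,j=1}^n\big[\tilde y_{i,j}\,l(w^\top\tilde x_{i,j})+(1-\tilde y_{i,j})\,l(-w^\top\tilde x_{i,j})\big].$$ $\mathbb{E}_\kappa$ is expectation over $S$ and the $\lambda_{i,j}$. *)

theory Defs
  imports "HOL-Probability.Probability"
begin

definition positive_definite :: "real ^ 'd ^ 'd \<Rightarrow> bool" where
  "positive_definite A \<longleftrightarrow>
     transpose A = A \<and> (\<forall>x. x \<noteq> 0 \<longrightarrow> x \<bullet> (A *v x) > 0)"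

definition spectral_norm :: "real ^ 'd ^ 'd \<Rightarrow> real" where
  "spectral_norm A = onorm ((*v) A)"

text \<open>Only meaningful for a positive definite covariance matrix \<open>V\<close>.\<close>
definition gaussian :: "real ^ 'd \<Rightarrow> real ^ 'd ^ 'd \<Rightarrow> (real ^ 'd) measure" where
  "gaussian m V = density lborel
     (\<lambda>x. ennreal (exp (- ((x - m) \<bullet> (matrix_inv V *v (x - m))) / 2)
                     / sqrt ((2 * pi) ^ CARD('d) * det V)))"

definition data_dist ::
    "real ^ 'd \<Rightarrow> real ^ 'd ^ 'd \<Rightarrow> real \<Rightarrow> ((real ^ 'd) \<times> real) measure" where
  "data_dist \<mu> \<Sigma> \<kappa> =
     measure_pmf (pmf_of_set {0, 1}) \<bind>
       (\<lambda>y. distr (gaussian (if y = 1 then \<mu> else - \<mu>) (inverse \<kappa> *\<^sub>R \<Sigma>))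
               (borel \<Otimes>\<^sub>M borel) (\<lambda>x. (x, y)))"

definition logistic_loss :: "real \<Rightarrow> real" where
  "logistic_loss z = ln (1 + exp (- z))"

definition mix_point ::
    "(real \<Rightarrow> real) \<Rightarrow> (nat \<Rightarrow> (real ^ 'd) \<times> real) \<Rightarrow> (nat \<times> nat \<Rightarrow> real)
      \<Rightarrow> nat \<Rightarrow> nat \<Rightarrow> real ^ 'd" where
  "mix_point g S lam i j =
     g (lam (i, j)) *\<^sub>R fst (S i) + (1 - g (lam (i, j))) *\<^sub>R fst (S j)"

definition mix_label ::
    "(nat \<Rightarrow> (real ^ 'd) \<times> real) \<Rightarrow> (nat \<times> nat \<Rightarrow> real) \<Rightarrow> nat \<Rightarrow> nat \<Rightarrow> real" where
  "mix_label S lam i j = lam (i, j) * snd (S i) + (1 - lam (i, j)) * snd (S j)"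

definition mixup_loss ::
    "(real \<Rightarrow> real) \<Rightarrow> nat \<Rightarrow> (nat \<Rightarrow> (real ^ 'd) \<times> real) \<Rightarrow> (nat \<times> nat \<Rightarrow> real)
      \<Rightarrow> real ^ 'd \<Rightarrow> real" where
  "mixup_loss g n S lam w =
     1 / (real n)\<^sup>2 *
     (\<Sum>i = 1..n. \<Sum>j = 1..n.
        mix_label S lam i j * logistic_loss (w \<bullet> mix_point g S lam i j)
        + (1 - mix_label S lam i j) * logistic_loss (- (w \<bullet> mix_point g S lam i j)))"

text \<open>Joint law of the sample \<open>S\<close> and the mixing coefficients \<open>\<lambda>\<^sub>i\<^sub>j\<close>:
  all coordinates are independent.\<close>
definition mixup_space ::
    "real ^ 'd \<Rightarrow> real ^ 'd ^ 'd \<Rightarrow> real measure \<Rightarrow> nat \<Rightarrow> real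
      \<Rightarrow> ((nat \<Rightarrow> (real ^ 'd) \<times> real) \<times> (nat \<times> nat \<Rightarrow> real)) measure" where
  "mixup_space \<mu> \<Sigma> \<Lambda> n \<kappa> =
     PiM {1..n} (\<lambda>_. data_dist \<mu> \<Sigma> \<kappa>) \<Otimes>\<^sub>M PiM ({1..n} \<times> {1..n}) (\<lambda>_. \<Lambda>)"

definition expected_mixup_loss ::
    "real ^ 'd \<Rightarrow> real ^ 'd ^ 'd \<Rightarrow> real measure \<Rightarrow> (real \<Rightarrow> real) \<Rightarrow> nat \<Rightarrow> real
      \<Rightarrow> real ^ 'd \<Rightarrow> real" where
  "expected_mixup_loss \<mu> \<Sigma> \<Lambda> g n \<kappa> w =
     (LINT (S, lam)|mixup_space \<mu> \<Sigma> \<Lambda> n \<kappa>. mixup_loss g n S lam w)"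

text \<open>Admissible Mixup parameters. \<open>\<Lambda>\<close> is a Borel probability measure on the unit
  interval itself, so that only the values of \<open>g\<close> on \<open>[0,1]\<close> are used; measurability of
  \<open>g\<close> makes the mixed points random variables.\<close>
definition mixup_params :: "real measure \<Rightarrow> (real \<Rightarrow> real) \<Rightarrow> bool" where
  "mixup_params \<Lambda> g \<longleftrightarrow>
     prob_space \<Lambda> \<and> sets \<Lambda> = sets (restrict_space borel {0..1}) \<and>
     g \<in> borel_measurable \<Lambda> \<and>
     (\<forall>z\<in>{0..1}. g z \<in> {0..1}) \<and>
     (\<forall>z\<in>{0..1}. g z > 1/2 \<longleftrightarrow> z > 1/2) \<and>
     measure \<Lambda> {z \<in> space \<Lambda>. z \<notin> {0, 1} \<and> g z \<noteq> 1/2} > 0"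

end

theory Submission
  imports Defs
begin

text \<open>
  Since \<open>l(-z) = l(z) + z\<close>, each summand of the loss is \<open>l(z) + (1 - y) z\<close> with
  \<open>z = w \<bullet> x\<close>, where \<open>x\<close> and \<open>y\<close> are the mixed point and label. The
  diagonal summands alone (\<open>i = j\<close>, no mixing) make the expected loss strictly convex and coercive,
  because a nondegenerate Gaussian gives no mass to hyperplanes and positive mass to half-spaces;
  hence there is exactly one minimizer. The law of the sample is invariant under the linear map that fixes
  \<open>\<mu>\<close> and preserves \<open>\<Sigma>\<close>, whose transpose fixes \<open>\<Sigma>\<^sup>-\<^sup>1 \<mu>\<close> and negates the
  orthogonal complement of \<open>\<mu>\<close>; uniqueness therefore puts the minimizer on the line through
  \<open>\<Sigma>\<^sup>-\<^sup>1 \<mu>\<close>. Finally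
  \<open>ln 2 - (y - 1/2) z \<le> l(z) + (1 - y) z \<le> ln 2 + z\<^sup>2/8 - (y - 1/2) z\<close>, and the expectation of
  \<open>(y - 1/2) z\<close> is positive at \<open>w = \<Sigma>\<^sup>-\<^sup>1 \<mu>\<close>, because labels and points of distinct samples are
  uncorrelated; so the loss drops below its value \<open>ln 2\<close> at the
  origin in the positive direction, and stays above it in the negative one.
\<close>

section \<open>Linear changes of variables\<close>

text \<open>\<open>gaussian\<close> is defined by a density containing \<open>matrix_inv\<close>, so
  its properties are won by transport: a factorization \<open>V = B ** transpose B\<close> and the
  change of variables for \<open>lborel\<close> under a matrix make it an affine image of the
  standard Gaussian, whose density is a product over coordinates. Second moment, mean and linear
  invariance come from there; null sets are read off the density itself. One reflection is enough
  for the direction, since the vectors fixed by its transpose are exactly the multiples of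
  \<open>\<Sigma>\<^sup>-\<^sup>1 \<mu>\<close>. Symmetry says nothing about the sign of the factor;
  that takes first-order information at the origin. The two-sided bound supplies it without
  differentiating under the expectation: both sides have the same linear term, and 1/8 is half of
  the bound 1/4 on the second derivative of the logistic loss. Strict convexity alone would not give
  existence. Coercivity is read off a hinge function below the loss: it is positively homogeneous,
  so positivity on the compact unit sphere becomes linear growth.\<close>

lemma borel_measurable_matrix_vector_mult [measurable]:
  fixes B :: "real ^ 'n ^ 'm"
  shows "(\<lambda>z. B *v z) \<in> borel_measurable borel"
  by (intro borel_measurable_continuous_onI linear_continuous_on matrix_vector_mul_bounded_linear)

text \<open>Coordinate \<open>p\<close> is translated by an amount that depends on another
  coordinate only. Integrating over \<open>p\<close> innermost, the claim becomes translation
  invariance on the real line.\<close>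

lemma nn_integral_lborel_shear:
  fixes p q :: "'a :: euclidean_space"
  assumes pq: "p \<in> Basis" "q \<in> Basis" "p \<noteq> q" and [measurable]: "f \<in> borel_measurable borel"
  shows "(\<integral>\<^sup>+z. f (z + (z \<bullet> q) *\<^sub>R p) \<partial>lborel) = (\<integral>\<^sup>+z. f z \<partial>lborel)"
proof -
  interpret product_sigma_finite "\<lambda>_ :: 'a. lborel :: real measure" ..
  define J :: "'a set" where "J = Basis - {p}"
  have B: "Basis = insert p J" "p \<notin> J" "finite J" "q \<in> J"
    using pq by (auto simp: J_def)
  define E :: "('a \<Rightarrow> real) \<Rightarrow> 'a" where "E X = (\<Sum>b\<in>Basis. X b *\<^sub>R b)" for X
  have E[measurable]: "E \<in> borel_measurable (Pi\<^sub>M (insert p J) (\<lambda>_. lborel))"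
    unfolding E_def[abs_def] B(1)[symmetric] by measurable
  have lE: "(lborel :: 'a measure) = distr (Pi\<^sub>M (insert p J) (\<lambda>_. lborel)) borel E"
    unfolding E_def[abs_def] B(1)[symmetric] by (rule lborel_eq)
  have Eq: "E X \<bullet> q = X q" for X
    using pq by (simp add: E_def inner_sum_left inner_Basis if_distrib sum.delta cong: if_cong)
  \<comment> \<open>As \<open>q \<noteq> p\<close>, updating \<open>p\<close> leaves
    \<open>X q\<close> alone. The factor \<open>1\<close> matches the affine form
    \<open>t + c * x\<close> of \<open>nn_integral_real_affine\<close>.\<close>
  have upd: "E (X(p := y)) + (E (X(p := y)) \<bullet> q) *\<^sub>R p = E (X(p := X q + 1 * y))" for X y
  proof -
    have "E (X(p := c)) = c *\<^sub>R p + (\<Sum>b\<in>J. X b *\<^sub>R b)" for c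
      using B unfolding E_def B(1) by (simp add: sum.insert) (auto intro!: sum.cong)
    then show ?thesis
      unfolding Eq using pq by (simp add: scaleR_add_left algebra_simps)
  qed
  have "(\<integral>\<^sup>+z. f (z + (z \<bullet> q) *\<^sub>R p) \<partial>lborel) =
      (\<integral>\<^sup>+X. f (E X + (E X \<bullet> q) *\<^sub>R p) \<partial>Pi\<^sub>M (insert p J) (\<lambda>_. lborel))"
    unfolding lE by (rule nn_integral_distr) auto
  also have "\<dots> = (\<integral>\<^sup>+X. \<integral>\<^sup>+y. f (E (X(p := X q + 1 * y))) \<partial>lborel \<partial>Pi\<^sub>M J (\<lambda>_. lborel))"
    using B(2,3) by (subst product_nn_integral_insert) (auto simp: upd)
  also have "\<dots> = (\<integral>\<^sup>+X. \<integral>\<^sup>+y. f (E (X(p := y))) \<partial>lborel \<partial>Pi\<^sub>M J (\<lambda>_. lborel))"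
  proof (rule nn_integral_cong)
    fix X :: "'a \<Rightarrow> real"
    have [measurable]: "(\<lambda>y. f (E (X(p := y)))) \<in> borel_measurable borel"
    proof -
      have "(\<lambda>y. \<Sum>b\<in>Basis. (X(p := y)) b *\<^sub>R b) \<in> borel_measurable borel"
        by (intro borel_measurable_sum borel_measurable_scaleR borel_measurable_const)
          (simp add: fun_upd_def)
      then show ?thesis unfolding E_def by measurable
    qed
    show "(\<integral>\<^sup>+y. f (E (X(p := X q + 1 * y))) \<partial>lborel) = (\<integral>\<^sup>+y. f (E (X(p := y))) \<partial>lborel)"
      using nn_integral_real_affine[of "\<lambda>y. f (E (X(p := y)))" 1 "X q"] by simp
  qed
  also have "\<dots> = (\<integral>\<^sup>+X. f (E X) \<partial>Pi\<^sub>M (insert p J) (\<lambda>_. lborel))"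
    using B(2,3) by (subst product_nn_integral_insert) auto
  also have "\<dots> = (\<integral>\<^sup>+z. f z \<partial>lborel)"
    unfolding lE by (rule nn_integral_distr[symmetric]) auto
  finally show ?thesis .
qed

lemma axis_1_nth: "axis j (1 :: 'a :: zero_neq_one) $ i = (if i = j then 1 else 0)"
  by (simp add: axis_def)

text \<open>The formula is stable under products because determinants multiply, so it is enough to
  check elementary matrices: diagonal ones scale each axis, swaps permute the sides of boxes, and
  shears preserve volume.\<close>

lemma nn_integral_lborel_matrix:
  fixes A :: "real ^ 'n ^ 'n"
  assumes "det A \<noteq> 0" "f \<in> borel_measurable borel"
  shows "(\<integral>\<^sup>+z. f z \<partial>lborel) = ennreal \<bar>det A\<bar> * (\<integral>\<^sup>+z. f (A *v z) \<partial>lborel)"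
proof -
  \<comment> \<open>The quantifier over \<open>f\<close> sits inside \<open>P\<close> because the
    product case uses the hypothesis for \<open>B\<close> on \<open>f\<close> composed with
    \<open>A\<close>. The guard on the determinant makes the case of a zero row vacuous.\<close>
  define P where "P A \<longleftrightarrow> (det A \<noteq> 0 \<longrightarrow> (\<forall>f\<in>borel_measurable borel.
      (\<integral>\<^sup>+z. f z \<partial>lborel) = ennreal \<bar>det A\<bar> * (\<integral>\<^sup>+z. f (A *v z) \<partial>lborel)))"
    for A :: "real ^ 'n ^ 'n"
  have "P A"
  proof (rule induct_matrix_elementary_alt[of P])
    fix A B :: "real ^ 'n ^ 'n"
    assume A: "P A" and B: "P B"
    show "P (A ** B)"
    unfolding P_def
    proof (intro impI ballI)
      fix f :: "real ^ 'n \<Rightarrow> ennreal"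
      assume d: "det (A ** B) \<noteq> 0" and f[measurable]: "f \<in> borel_measurable borel"
      have "(\<integral>\<^sup>+z. f z \<partial>lborel) = ennreal \<bar>det A\<bar> * (\<integral>\<^sup>+z. f (A *v z) \<partial>lborel)"
        using A d f unfolding P_def det_mul by (metis mult_zero_left)
      also have "(\<integral>\<^sup>+z. f (A *v z) \<partial>lborel) = ennreal \<bar>det B\<bar> * (\<integral>\<^sup>+z. f (A *v (B *v z)) \<partial>lborel)"
        by (rule B[unfolded P_def, rule_format]) (use d in \<open>auto simp: det_mul\<close>)
      finally show "(\<integral>\<^sup>+z. f z \<partial>lborel) =
          ennreal \<bar>det (A ** B)\<bar> * (\<integral>\<^sup>+z. f ((A ** B) *v z) \<partial>lborel)"
        by (simp add: det_mul abs_mult ennreal_mult matrix_vector_mul_assoc mult.assoc)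
    qed
  next
    fix A :: "real ^ 'n ^ 'n" and i
    assume "row i A = 0"
    then show "P A" by (simp add: P_def det_zero_row)
  next
    fix A :: "real ^ 'n ^ 'n"
    assume A: "\<And>i j. i \<noteq> j \<Longrightarrow> A $ i $ j = 0"
    show "P A"
    unfolding P_def
    proof (intro impI ballI)
      fix f :: "real ^ 'n \<Rightarrow> ennreal"
      assume d: "det A \<noteq> 0" and f[measurable]: "f \<in> borel_measurable borel"
      have detA: "det A = (\<Prod>i\<in>UNIV. A $ i $ i)"
        using A by (rule det_diagonal)
      \<comment> \<open>The diagonal entries, indexed by basis vectors as
        \<open>lborel_affine_euclidean\<close> expects them.\<close>
      define c :: "real ^ 'n \<Rightarrow> real" where "c b = b \<bullet> (A *v b)" for b
      have Az: "(A *v z) $ i = A $ i $ i * z $ i" for z i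
      proof -
        have "(A *v z) $ i = (\<Sum>j\<in>UNIV. if j = i then A $ i $ i * z $ i else 0)"
          unfolding matrix_vector_mult_def vec_lambda_beta by (rule sum.cong) (auto simp: A)
        then show ?thesis by simp
      qed
      have cb: "c (axis i 1) = A $ i $ i" for i
        by (simp add: c_def inner_axis' Az)
      have Bas: "(Basis :: (real ^ 'n) set) = (\<lambda>i. axis i 1) ` UNIV"
        by (auto simp: Basis_vec_def)
      have inj: "inj (\<lambda>i :: 'n. axis i (1 :: real))"
        by (auto simp: inj_def axis_eq_axis)
      have c0: "c b \<noteq> 0" if "b \<in> Basis" for b
        using d that unfolding Bas by (auto simp: cb detA)
      have T: "0 + (\<Sum>b\<in>Basis. (c b * (z \<bullet> b)) *\<^sub>R b) = A *v z" for z
        unfolding Bas sum.reindex[OF inj]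
        by (simp add: vec_eq_iff cb Az inner_axis axis_1_nth if_distrib sum.delta cong: if_cong)
      have "(\<Prod>b\<in>Basis. \<bar>c b\<bar>) = \<bar>det A\<bar>"
        unfolding Bas prod.reindex[OF inj] by (simp add: cb detA abs_prod)
      then have "lborel = density (distr lborel borel (\<lambda>z. A *v z)) (\<lambda>_. ennreal \<bar>det A\<bar>)"
        using lborel_affine_euclidean[of c 0] c0 unfolding T by simp
      then have "(\<integral>\<^sup>+z. f z \<partial>lborel) =
          (\<integral>\<^sup>+z. f z \<partial>density (distr lborel borel (\<lambda>z. A *v z)) (\<lambda>_. ennreal \<bar>det A\<bar>))"
        by simp
      also have "\<dots> = ennreal \<bar>det A\<bar> * (\<integral>\<^sup>+z. f (A *v z) \<partial>lborel)"
        by (simp add: nn_integral_density nn_integral_distr nn_integral_cmult)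
      finally show "(\<integral>\<^sup>+z. f z \<partial>lborel) = ennreal \<bar>det A\<bar> * (\<integral>\<^sup>+z. f (A *v z) \<partial>lborel)" .
    qed
  next
    fix m n :: 'n
    assume "m \<noteq> n"
    define A :: "real ^ 'n ^ 'n" where "A = (\<chi> i j. mat 1 $ i $ Transposition.transpose m n j)"
    have Az: "(A *v z) $ i = z $ Transposition.transpose m n i" for z i
    proof -
      have "(A *v z) $ i = (\<Sum>j\<in>UNIV. if j = Transposition.transpose m n i then z $ j else 0)"
        unfolding A_def matrix_vector_mult_def mat_def vec_lambda_beta
        by (rule sum.cong) (auto simp: transpose_eq_iff)
      then show ?thesis by simp
    qed
    \<comment> \<open>Orthogonality is only a route to the value 1 of the absolute
      determinant.\<close>
    have "orthogonal_transformation ((*v) A)"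
      unfolding orthogonal_transformation
    proof (intro conjI allI)
      fix z :: "real ^ 'n"
      have "(A *v z) \<bullet> (A *v z) = (\<Sum>i\<in>UNIV. z $ Transposition.transpose m n i * z $ Transposition.transpose m n i)"
        by (simp add: inner_vec_def Az)
      also have "\<dots> = (\<Sum>i\<in>UNIV. z $ i * z $ i)"
        by (rule sum.reindex_bij_betw) simp
      finally show "norm (A *v z) = norm z"
        by (simp add: norm_eq inner_vec_def)
    qed simp
    then have detA: "\<bar>det A\<bar> = 1"
      using det_orthogonal_matrix[of A] orthogonal_transformation_matrix[of "(*v) A"] by auto
    have lA: "lborel = distr lborel borel ((*v) A)"
    proof (rule lborel_eqI)
      fix l u :: "real ^ 'n"
      assume lu: "\<And>b. b \<in> Basis \<Longrightarrow> l \<bullet> b \<le> u \<bullet> b"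
      have tr: "Transposition.transpose m n (Transposition.transpose m n i) = i" for i
        by simp
      have "(*v) A -` box l u = box (A *v l) (A *v u)"
        unfolding set_eq_iff vimage_eq mem_box_cart Az by (metis tr)
      moreover have "(A *v l) $ i \<le> (A *v u) $ i" for i
        using lu[of "axis k 1" for k] by (simp add: Az inner_axis)
      moreover have "(\<Prod>i\<in>UNIV. (A *v u) $ i - (A *v l) $ i) = (\<Prod>i\<in>UNIV. u $ i - l $ i)"
        unfolding Az by (rule prod.reindex_bij_betw) simp
      ultimately show "emeasure (distr lborel borel ((*v) A)) (box l u) = (\<Prod>b\<in>Basis. (u - l) \<bullet> b)"
        using lu by (simp add: emeasure_distr emeasure_lborel_box_eq Basis_vec_def inner_axis
            prod.UNION_disjoint axis_eq_axis prod.reindex inj_def image_UN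
            flip: vector_minus_component)
    qed simp
    have "(\<integral>\<^sup>+z. f z \<partial>lborel) = (\<integral>\<^sup>+z. f (A *v z) \<partial>lborel)" if "f \<in> borel_measurable borel" for f
      using that by (subst lA) (simp add: nn_integral_distr)
    then show "P (\<chi> i j. mat 1 $ i $ Transposition.transpose m n j)"
      unfolding A_def[symmetric] P_def detA by (metis ennreal_1 mult_1)
  next
    fix m n :: 'n
    assume mn: "m \<noteq> n"
    define A :: "real ^ 'n ^ 'n" where "A = (\<chi> i j. of_bool (i = m \<and> j = n \<or> i = j))"
    have Az: "A *v z = z + (z \<bullet> axis n 1) *\<^sub>R axis m 1" for z
    proof -
      have "(A *v z) $ i = z $ i + (if i = m then z $ n else 0)" for i
      proof -
        have "(A *v z) $ i = (\<Sum>j\<in>UNIV. (if j = i then z $ j else 0) + (if j = n then (if i = m then z $ n else 0) else 0))"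
          unfolding A_def matrix_vector_mult_def vec_lambda_beta using mn by (intro sum.cong) auto
        then show ?thesis by (simp add: sum.distrib)
      qed
      then show ?thesis
        by (simp add: vec_eq_iff inner_axis axis_1_nth)
    qed
    \<comment> \<open>A shear is one row operation on the identity, hence has determinant 1.\<close>
    have "A = (\<chi> k. if k = m then row m (mat 1) + 1 *s row n (mat 1) else row k (mat 1))"
      using mn by (auto simp: A_def vec_eq_iff row_def mat_def)
    then have "det A = 1"
      using det_row_operation[OF mn, of "mat 1 :: real ^ 'n ^ 'n" 1] by simp
    then show "P (\<chi> i j. of_bool (i = m \<and> j = n \<or> i = j))"
      unfolding A_def[symmetric] P_def Az
      using nn_integral_lborel_shear[of "axis m (1::real) :: real ^ 'n" "axis n 1"] mn
      by (auto simp: Basis_vec_def axis_eq_axis)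
  qed
  then show ?thesis using assms unfolding P_def by blast
qed

text \<open>Translation invariance joined to the determinant formula, put as an equation of measures
  so that it can be substituted for \<open>lborel\<close> inside \<open>gaussian\<close>.\<close>

lemma lborel_eq_density_distr_affine:
  fixes B :: "real ^ 'n ^ 'n" and m :: "real ^ 'n"
  assumes "invertible B"
  shows "lborel = density (distr lborel borel (\<lambda>z. m + B *v z)) (\<lambda>_. ennreal \<bar>det B\<bar>)"
proof (rule measure_eqI)
  fix X :: "(real ^ 'n) set"
  assume "X \<in> sets lborel"
  then have X[measurable]: "X \<in> sets borel" by simp
  have "det B \<noteq> 0"
    using assms invertible_det_nz by blast
  have "emeasure lborel X = emeasure (distr lborel borel ((+) m)) X"
    by (simp add: lborel_distr_plus)
  also have "\<dots> = (\<integral>\<^sup>+z. indicator X (m + z) \<partial>lborel)"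
    by (simp add: nn_integral_distr flip: nn_integral_indicator)
  also have "\<dots> = ennreal \<bar>det B\<bar> * (\<integral>\<^sup>+z. indicator X (m + B *v z) \<partial>lborel)"
    by (rule nn_integral_lborel_matrix) (use \<open>det B \<noteq> 0\<close> in auto)
  also have "(\<integral>\<^sup>+z. indicator X (m + B *v z) \<partial>lborel) = emeasure (distr lborel borel (\<lambda>z. m + B *v z)) X"
    by (simp add: nn_integral_distr flip: nn_integral_indicator)
  finally show "emeasure lborel X = emeasure (density (distr lborel borel (\<lambda>z. m + B *v z)) (\<lambda>_. ennreal \<bar>det B\<bar>)) X"
    by (simp add: emeasure_density_const)
qed simp

section \<open>Gaussian measures\<close>

lemma matrix_inv_eqI:
  fixes A :: "'a :: semiring_1 ^ 'n ^ 'm"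
  assumes "A ** B = mat 1" "B ** A = mat 1"
  shows "matrix_inv A = B"
proof -
  have "A ** matrix_inv A = mat 1 \<and> matrix_inv A ** A = mat 1"
    unfolding matrix_inv_def by (rule someI[of _ B]) (use assms in blast)
  then show ?thesis
    by (metis assms(2) matrix_mul_assoc matrix_mul_lid matrix_mul_rid)
qed

text \<open>Gram-Schmidt for the inner product defined by \<open>A\<close>. While \<open>k\<close>
  is below the dimension, the images under \<open>A\<close> of the vectors found so far cannot span
  the space, so some nonzero \<open>x\<close> is orthogonal to all of them; dividing by
  \<open>sqrt q\<close> normalizes it.\<close>

lemma positive_definite_orthonormal_set:
  fixes A :: "real ^ 'n ^ 'n"
  assumes A: "positive_definite A" and "k \<le> CARD('n)"
  shows "\<exists>W. finite W \<and> card W = k \<and>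
    (\<forall>v\<in>W. \<forall>w\<in>W. v \<bullet> (A *v w) = (if v = w then 1 else 0))"
  using assms(2)
proof (induction k)
  case 0
  then show ?case by (intro exI[of _ "{}"]) auto
next
  case (Suc k)
  then obtain W where W: "finite W" "card W = k"
    and on: "\<And>v w. v \<in> W \<Longrightarrow> w \<in> W \<Longrightarrow> v \<bullet> (A *v w) = (if v = w then 1 else 0)"
    by auto
  have "dim ((*v) A ` W) \<le> card ((*v) A ` W)"
    using W by (intro dim_le_card') auto
  also have "\<dots> \<le> k"
    using W card_image_le by blast
  finally have "dim ((*v) A ` W) < DIM(real ^ 'n)"
    using Suc by simp
  then obtain x where x: "x \<noteq> 0" "\<And>y. y \<in> span ((*v) A ` W) \<Longrightarrow> orthogonal x y"
    using orthogonal_to_subspace_exists by blast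
  define q where "q = x \<bullet> (A *v x)"
  have q: "q > 0"
    using A x unfolding q_def positive_definite_def by blast
  define b where "b = (1 / sqrt q) *\<^sub>R x"
  have bw: "b \<bullet> (A *v w) = 0" if "w \<in> W" for w
    using x(2)[of "A *v w"] that by (auto simp: b_def orthogonal_def span_base)
  have wb: "w \<bullet> (A *v b) = 0" if "w \<in> W" for w
    using bw[OF that] A
    by (metis dot_lmul_matrix inner_commute positive_definite_def transpose_matrix_vector)
  have bb: "b \<bullet> (A *v b) = 1"
    using q by (simp add: b_def matrix_vector_mult_scaleR flip: q_def)
  have "b \<notin> W" using bb bw by fastforce
  then show ?case
    using W on bw wb bb by (intro exI[of _ "insert b W"]) auto
qed

text \<open>The vectors of a \<open>V\<close>-orthonormal basis, taken as the rows of
  \<open>C\<close>, give \<open>C ** V ** transpose C = mat 1\<close>. The factor \<open>B\<close>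
  is the inverse of \<open>C\<close>.\<close>

lemma positive_definite_factorization:
  fixes V :: "real ^ 'n ^ 'n"
  assumes V: "positive_definite V"
  obtains B :: "real ^ 'n ^ 'n" where "invertible B" "V = B ** transpose B"
proof -
  obtain W where W: "finite W" "card W = CARD('n)"
    and on: "\<And>v w. v \<in> W \<Longrightarrow> w \<in> W \<Longrightarrow> v \<bullet> (V *v w) = (if v = w then 1 else 0)"
    using positive_definite_orthonormal_set[OF V order_refl] by blast
  obtain c :: "'n \<Rightarrow> real ^ 'n" where c: "bij_betw c UNIV W"
    using finite_same_card_bij[of "UNIV :: 'n set" W] W by auto
  define C :: "real ^ 'n ^ 'n" where "C = (\<chi> i. c i)"
  have "C ** (V ** transpose C) = mat 1"
  proof -
    have "(C ** (V ** transpose C)) $ i $ j = c i \<bullet> (V *v c j)" for i j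
      by (simp add: C_def matrix_matrix_mult_def inner_vec_def transpose_def matrix_vector_mult_def)
    moreover have "c i \<bullet> (V *v c j) = (if i = j then 1 else 0)" for i j
      using on[of "c i" "c j"] c by (auto simp: bij_betw_def inj_eq)
    ultimately show ?thesis
      by (simp add: vec_eq_iff mat_def)
  qed
  note CVC = this
  \<comment> \<open>A one-sided inverse of a square matrix is two-sided, which already makes
    \<open>C\<close> invertible.\<close>
  have "(V ** transpose C) ** C = mat 1"
    using CVC matrix_left_right_inverse by blast
  then have invC: "invertible C"
    using CVC unfolding invertible_def by blast
  then obtain D where D: "C ** D = mat 1" "D ** C = mat 1"
    unfolding invertible_def by blast
  have D': "transpose C ** transpose D = mat 1"
    using D by (metis matrix_transpose_mul transpose_mat)
  have "V = (D ** C) ** V ** (transpose C ** transpose D)"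
    by (simp add: D D')
  also have "\<dots> = D ** (C ** (V ** transpose C)) ** transpose D"
    by (simp only: matrix_mul_assoc)
  finally have "V = D ** transpose D"
    by (simp add: CVC)
  moreover have "invertible D"
    using D unfolding invertible_def by blast
  ultimately show thesis using that by blast
qed

text \<open>Substituting \<open>m + B *v z\<close> turns the quadratic form into
  \<open>z \<bullet> z\<close>, and the Jacobian cancels the square root of the determinant of
  \<open>B ** transpose B\<close>, which is the absolute determinant of \<open>B\<close>.\<close>

lemma gaussian_affine_standard:
  fixes B :: "real ^ 'n ^ 'n" and m :: "real ^ 'n"
  assumes "invertible B"
  shows "gaussian m (B ** transpose B) = distr (gaussian 0 (mat 1)) borel (\<lambda>z. m + B *v z)"
proof -
  let ?T = "\<lambda>z. m + B *v z" and ?V = "B ** transpose B"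
  let ?f = "\<lambda>m V x. ennreal (exp (- ((x - m) \<bullet> (matrix_inv V *v (x - m))) / 2)
                     / sqrt ((2 * pi) ^ CARD('n) * det V))"
  have f[measurable]: "?f m V \<in> borel_measurable borel" for m V
    by measurable
  obtain C where C: "B ** C = mat 1" "C ** B = mat 1"
    using assms unfolding invertible_def by blast
  have Ct: "transpose B ** transpose C = mat 1" "transpose C ** transpose B = mat 1"
    using C by (metis matrix_transpose_mul transpose_mat)+
  have "?V ** (transpose C ** C) = B ** (transpose B ** transpose C) ** C"
    by (simp only: matrix_mul_assoc)
  then have VC: "?V ** (transpose C ** C) = mat 1" by (simp add: C Ct)
  then have VC': "(transpose C ** C) ** ?V = mat 1"
    using matrix_left_right_inverse by blast
  have invV: "matrix_inv ?V = transpose C ** C"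
    using VC VC' by (rule matrix_inv_eqI)
  have inv1: "matrix_inv (mat 1 :: real ^ 'n ^ 'n) = mat 1"
    by (rule matrix_inv_eqI) auto
  have detB: "det B \<noteq> 0"
    using assms invertible_det_nz by blast
  have "(transpose C ** C) *v (B *v z) = transpose C *v z" for z
    by (simp add: matrix_vector_mul_assoc C flip: matrix_mul_assoc)
  moreover have "(B *v z) \<bullet> (transpose C *v z) = z \<bullet> z" for z
    by (metis C(2) dot_lmul_matrix inner_commute matrix_vector_mul_assoc matrix_vector_mul_lid
        transpose_matrix_vector transpose_transpose)
  ultimately have quad: "(?T z - m) \<bullet> (matrix_inv ?V *v (?T z - m)) = z \<bullet> z" for z
    by (simp add: invV)
  have dens: "ennreal \<bar>det B\<bar> * ?f m ?V (?T z) = ?f 0 (mat 1) z" for z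
    unfolding quad inv1
    using detB by (subst ennreal_mult'[symmetric])
      (auto simp: det_mul real_sqrt_mult real_sqrt_abs2)
  have "gaussian m ?V = density (density (distr lborel borel ?T) (\<lambda>_. ennreal \<bar>det B\<bar>)) (?f m ?V)"
    unfolding gaussian_def by (subst lborel_eq_density_distr_affine[OF assms, of m]) simp
  also have "\<dots> = density (distr lborel borel ?T) (\<lambda>x. ennreal \<bar>det B\<bar> * ?f m ?V x)"
    by (subst density_density_eq) auto
  also have "\<dots> = distr (density lborel (\<lambda>z. ennreal \<bar>det B\<bar> * ?f m ?V (?T z))) borel ?T"
    by (subst density_distr) auto
  finally show ?thesis
    unfolding dens by (simp add: gaussian_def)
qed

text \<open>The product form opens the way to Fubini: integrals over the space become products of
  one-dimensional ones.\<close>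

lemma gaussian_standard_density:
  "gaussian 0 (mat 1 :: real ^ 'n ^ 'n) =
    density lborel (\<lambda>z. ennreal (\<Prod>b\<in>Basis. std_normal_density (z \<bullet> b)))"
proof -
  have inv1: "matrix_inv (mat 1 :: real ^ 'n ^ 'n) = mat 1"
    by (rule matrix_inv_eqI) auto
  have "(\<Prod>b\<in>Basis. std_normal_density (z \<bullet> b)) = exp (- (z \<bullet> z) / 2) / sqrt ((2 * pi) ^ CARD('n))"
    for z :: "real ^ 'n"
  proof -
    have "(\<Prod>b\<in>Basis. std_normal_density (z \<bullet> b)) =
        (1 / sqrt (2 * pi)) ^ CARD('n) * exp (\<Sum>b\<in>Basis. - (z \<bullet> b)\<^sup>2 / 2)"
      by (simp add: std_normal_density_def prod.distrib exp_sum prod_dividef power_one_over)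
    also have "(\<Sum>b\<in>Basis. - (z \<bullet> b)\<^sup>2 / 2) = - (z \<bullet> z) / 2"
      by (subst euclidean_inner[of z z]) (simp add: power2_eq_square sum_negf sum_divide_distrib)
    finally show ?thesis
      by (simp add: real_sqrt_power power_one_over real_sqrt_mult power_mult_distrib)
  qed
  then show ?thesis
    by (simp add: gaussian_def inv1)
qed

lemma nn_integral_gaussian_standard_prod:
  fixes f :: "real ^ 'n \<Rightarrow> real \<Rightarrow> real"
  assumes [measurable]: "\<And>b. f b \<in> borel_measurable borel" and "\<And>b x. f b x \<ge> 0"
  shows "(\<integral>\<^sup>+z. ennreal (\<Prod>b\<in>Basis. f b (z \<bullet> b)) \<partial>gaussian 0 (mat 1 :: real ^ 'n ^ 'n)) =
    (\<Prod>b\<in>Basis. \<integral>\<^sup>+x. ennreal (std_normal_density x * f b x) \<partial>lborel)"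
proof -
  have "(\<integral>\<^sup>+z. ennreal (\<Prod>b\<in>Basis. f b (z \<bullet> b)) \<partial>gaussian 0 (mat 1 :: real ^ 'n ^ 'n)) =
      (\<integral>\<^sup>+z. (\<Prod>b\<in>Basis. ennreal (std_normal_density (z \<bullet> b) * f b (z \<bullet> b))) \<partial>lborel)"
    unfolding gaussian_standard_density using assms
    by (subst nn_integral_density)
      (auto simp: prod.distrib prod_ennreal prod_nonneg simp flip: ennreal_mult)
  also have "\<dots> = (\<Prod>b\<in>Basis. \<integral>\<^sup>+x. ennreal (std_normal_density x * f b x) \<partial>lborel)"
    by (intro nn_integral_lborel_prod) auto
  finally show ?thesis .
qed

lemma nn_integral_std_normal_density: "(\<integral>\<^sup>+x. ennreal (std_normal_density x) \<partial>lborel) = 1"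
  using prob_space.emeasure_space_1[OF prob_space_normal_density[of 1 0]]
  by (simp add: emeasure_density)

lemma sets_gaussian [simp, measurable_cong]: "sets (gaussian m V) = sets borel"
  by (simp add: gaussian_def)

lemma space_gaussian [simp]: "space (gaussian m V) = UNIV"
  by (simp add: gaussian_def)

lemma prob_space_gaussian_standard: "prob_space (gaussian 0 (mat 1 :: real ^ 'n ^ 'n))"
proof
  have "emeasure (gaussian 0 (mat 1 :: real ^ 'n ^ 'n)) UNIV = 1"
    using nn_integral_gaussian_standard_prod[of "\<lambda>(_ :: real ^ 'n) _. 1"]
    by (simp add: nn_integral_std_normal_density)
  then show "emeasure (gaussian 0 (mat 1 :: real ^ 'n ^ 'n)) (space (gaussian 0 (mat 1))) = 1"
    by simp
qed

lemma integrable_gaussian_standard_norm_sq: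
  "integrable (gaussian 0 (mat 1 :: real ^ 'n ^ 'n)) (\<lambda>z. (norm z)\<^sup>2)"
proof -
  have "integrable (gaussian 0 (mat 1 :: real ^ 'n ^ 'n)) (\<lambda>z. (z \<bullet> b)\<^sup>2)" if b: "b \<in> Basis" for b
  proof (rule integrableI_nonneg)
    \<comment> \<open>The square of one coordinate is padded with factors 1 to fit the product
      rule.\<close>
    have "(\<integral>\<^sup>+z. ennreal ((z \<bullet> b)\<^sup>2) \<partial>gaussian 0 (mat 1 :: real ^ 'n ^ 'n)) =
        (\<integral>\<^sup>+z. ennreal (\<Prod>c\<in>Basis. if c = b then (z \<bullet> c)\<^sup>2 else 1)
          \<partial>gaussian 0 (mat 1 :: real ^ 'n ^ 'n))"
      using b by (simp add: prod.delta)
    also have "\<dots> = (\<Prod>c\<in>Basis. \<integral>\<^sup>+x. ennreal (std_normal_density x * (if c = b then x\<^sup>2 else 1)) \<partial>lborel)"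
      by (rule nn_integral_gaussian_standard_prod) auto
    also have "\<dots> < \<infinity>"
    proof -
      have "(\<integral>\<^sup>+x. ennreal (std_normal_density x * x\<^sup>2) \<partial>lborel) < \<infinity>"
        using integrable_std_normal_moment[of 2] by (simp add: integrable_iff_bounded abs_mult)
      then have "(\<integral>\<^sup>+x. ennreal (std_normal_density x * (if c = b then x\<^sup>2 else 1)) \<partial>lborel) < \<infinity>" for c
        by (cases "c = b") (auto simp: nn_integral_std_normal_density)
      then show ?thesis
        unfolding infinity_ennreal_def less_top[symmetric] ennreal_prod_eq_top by blast
    qed
    finally show "(\<integral>\<^sup>+z. ennreal ((z \<bullet> b)\<^sup>2) \<partial>gaussian 0 (mat 1 :: real ^ 'n ^ 'n)) < \<infinity>" .
  qed auto
  then have "integrable (gaussian 0 (mat 1 :: real ^ 'n ^ 'n)) (\<lambda>z. \<Sum>b\<in>Basis. (z \<bullet> b)\<^sup>2)"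
    by auto
  moreover have "(\<Sum>b\<in>Basis. (z \<bullet> b)\<^sup>2) = (norm z)\<^sup>2" for z :: "real ^ 'n"
    by (simp add: norm_eq_sqrt_inner euclidean_inner[of z z] power2_eq_square sum_nonneg)
  ultimately show ?thesis by simp
qed

text \<open>Lets a second moment dominate first moments, so that one integrability fact serves all
  later integrands.\<close>

lemma le_one_plus_square: "x \<le> 1 + x\<^sup>2" for x :: real
  using sum_squares_bound[of x 1] zero_le_power2[of x] by (simp, linarith)

section \<open>Gaussians with a general covariance: transport, moments and null sets\<close>

lemma positive_definite_scaleR:
  assumes "positive_definite A" "c > 0"
  shows "positive_definite (c *\<^sub>R A)"
  using assms by (simp add: positive_definite_def transpose_scalar scaleR_matrix_vector_assoc[symmetric])

lemma det_positive_definite_pos: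
  assumes "positive_definite (V :: real ^ 'n ^ 'n)"
  shows "det V > 0"
proof -
  obtain B :: "real ^ 'n ^ 'n" where B: "invertible B" "V = B ** transpose B"
    using positive_definite_factorization[OF assms] .
  have "det B \<noteq> 0"
    using B(1) invertible_det_nz by blast
  then show ?thesis
    by (simp add: B(2) det_mul power2_eq_square[symmetric])
qed

lemma prob_space_gaussian:
  fixes V :: "real ^ 'n ^ 'n"
  assumes "positive_definite V"
  shows "prob_space (gaussian m V)"
proof -
  obtain B :: "real ^ 'n ^ 'n" where B: "invertible B" "V = B ** transpose B"
    using positive_definite_factorization[OF assms] .
  interpret prob_space "gaussian 0 (mat 1) :: (real ^ 'n) measure"
    by (rule prob_space_gaussian_standard)
  have "prob_space (gaussian m (B ** transpose B))"
    by (subst gaussian_affine_standard[OF B(1)], rule prob_space_distr,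
        subst measurable_cong_sets[OF sets_gaussian refl]) measurable
  then show ?thesis
    by (simp only: B(2))
qed

text \<open>If \<open>B\<close> factors \<open>V\<close>, then \<open>M ** B\<close> factors the new
  covariance, and composing the two affine maps of the standard Gaussian gives the claim. It yields
  the point reflection below and the symmetry of the data law.\<close>

lemma gaussian_affine:
  fixes V M :: "real ^ 'n ^ 'n"
  assumes "positive_definite V" "invertible M"
  shows "distr (gaussian m V) borel (\<lambda>x. c + M *v x) = gaussian (c + M *v m) (M ** V ** transpose M)"
proof -
  obtain B :: "real ^ 'n ^ 'n" where B: "invertible B" "V = B ** transpose B"
    using positive_definite_factorization[OF assms(1)] .
  have "distr (gaussian m V) borel (\<lambda>x. c + M *v x) =
      distr (gaussian 0 (mat 1)) borel ((\<lambda>x. c + M *v x) \<circ> (\<lambda>z. m + B *v z))"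
    unfolding B(2) gaussian_affine_standard[OF B(1)] by (rule distr_distr) simp_all
  also have "(\<lambda>x. c + M *v x) \<circ> (\<lambda>z. m + B *v z) = (\<lambda>z. (c + M *v m) + (M ** B) *v z)"
    by (simp add: fun_eq_iff matrix_vector_right_distrib matrix_vector_mul_assoc)
  also have "distr (gaussian 0 (mat 1)) borel \<dots> =
      gaussian (c + M *v m) ((M ** B) ** transpose (M ** B))"
    by (rule gaussian_affine_standard[symmetric]) (simp add: assms(2) B(1) invertible_mult)
  also have "(M ** B) ** transpose (M ** B) = M ** V ** transpose M"
    by (simp add: B(2) matrix_transpose_mul matrix_mul_assoc)
  finally show ?thesis .
qed

text \<open>The matrix \<open>- mat 1\<close> preserves every covariance. With \<open>c\<close>
  twice the mean this is the symmetry of a Gaussian about its mean.\<close>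

lemma gaussian_uminus:
  fixes V :: "real ^ 'n ^ 'n"
  assumes "positive_definite V"
  shows "distr (gaussian m V) borel (\<lambda>x. c - x) = gaussian (c - m) V"
proof -
  let ?M = "- mat 1 :: real ^ 'n ^ 'n"
  have neg: "?M *v x = - x" for x
    by (simp add: vec_eq_iff matrix_vector_mult_def mat_def sum_negf if_distrib
        if_distribR sum.delta cong: if_cong)
  have tr: "transpose ?M = ?M"
    by (simp add: transpose_def mat_def vec_eq_iff)
  have sq: "?M ** V ** ?M = V"
    by (simp add: matrix_eq matrix_vector_mul_assoc[symmetric] neg vec.neg)
  have "?M ** ?M = mat 1"
    by (simp add: matrix_eq matrix_vector_mul_assoc[symmetric] neg)
  then have "invertible ?M"
    unfolding invertible_def by blast
  from gaussian_affine[OF assms this, of m c] show ?thesis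
    by (simp add: neg tr sq)
qed

lemma integrable_gaussian_norm_sq:
  fixes V :: "real ^ 'n ^ 'n"
  assumes "positive_definite V"
  shows "integrable (gaussian m V) (\<lambda>x. (norm x)\<^sup>2)"
proof -
  obtain B :: "real ^ 'n ^ 'n" where B: "invertible B" "V = B ** transpose B"
    using positive_definite_factorization[OF assms] .
  interpret prob_space "gaussian 0 (mat 1) :: (real ^ 'n) measure"
    by (rule prob_space_gaussian_standard)
  obtain K where K: "\<And>z. norm (B *v z) \<le> norm z * K"
    using bounded_linear.bounded[OF matrix_vector_mul_bounded_linear[of B]] by blast
  have "(norm (m + B *v z))\<^sup>2 \<le> 2 * (norm m)\<^sup>2 + 2 * K\<^sup>2 * (norm z)\<^sup>2" for z
  proof -
    have "norm (m + B *v z) \<le> norm m + norm z * K"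
      using norm_triangle_ineq K add_left_mono order_trans by blast
    then have "(norm (m + B *v z))\<^sup>2 \<le> (norm m + norm z * K)\<^sup>2"
      by (rule power_mono) simp
    also have "\<dots> \<le> 2 * (norm m)\<^sup>2 + 2 * (norm z * K)\<^sup>2"
      using sum_squares_bound[of "norm m" "norm z * K"] by (simp add: power2_sum)
    finally show ?thesis by (simp add: power_mult_distrib mult_ac)
  qed
  note bound = this
  have meas: "(\<lambda>z. m + B *v z) \<in> gaussian 0 (mat 1) \<rightarrow>\<^sub>M borel"
    by (subst measurable_cong_sets[OF sets_gaussian refl]) measurable
  have "integrable (gaussian 0 (mat 1)) (\<lambda>z. (norm (m + B *v z))\<^sup>2)"
  proof (rule Bochner_Integration.integrable_bound)
    show "integrable (gaussian 0 (mat 1)) (\<lambda>z :: real ^ 'n. 2 * (norm m)\<^sup>2 + 2 * K\<^sup>2 * (norm z)\<^sup>2)"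
      by (intro Bochner_Integration.integrable_add integrable_const integrable_mult_right
          integrable_gaussian_standard_norm_sq)
    show "(\<lambda>z. (norm (m + B *v z))\<^sup>2) \<in> borel_measurable (gaussian 0 (mat 1))"
      using meas by measurable
    show "AE z in gaussian 0 (mat 1). norm ((norm (m + B *v z))\<^sup>2) \<le>
        norm (2 * (norm m)\<^sup>2 + 2 * K\<^sup>2 * (norm z)\<^sup>2)"
      using bound by simp
  qed
  then have "integrable (gaussian m (B ** transpose B)) (\<lambda>x. (norm x)\<^sup>2)"
    by (subst gaussian_affine_standard[OF B(1)], subst integrable_distr_eq[OF meas]) simp_all
  then show ?thesis
    by (simp only: B(2))
qed

lemma integrable_gaussian_inner:
  fixes V :: "real ^ 'n ^ 'n"
  assumes "positive_definite V"
  shows "integrable (gaussian m V) (\<lambda>x. u \<bullet> x)"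
proof -
  interpret prob_space "gaussian m V"
    by (rule prob_space_gaussian[OF assms])
  have "\<bar>u \<bullet> x\<bar> \<le> norm u * (1 + (norm x)\<^sup>2)" for x
  proof -
    have "\<bar>u \<bullet> x\<bar> \<le> norm u * norm x"
      by (rule Cauchy_Schwarz_ineq2)
    also have "norm x \<le> 1 + (norm x)\<^sup>2"
      by (rule le_one_plus_square)
    finally show ?thesis by (simp add: mult_left_mono)
  qed
  note bound = this
  show ?thesis
  proof (rule Bochner_Integration.integrable_bound)
    show "integrable (gaussian m V) (\<lambda>x. norm u * (1 + (norm x)\<^sup>2))"
      by (intro integrable_mult_right Bochner_Integration.integrable_add integrable_const
          integrable_gaussian_norm_sq[OF assms])
    show "(\<lambda>x. u \<bullet> x) \<in> borel_measurable (gaussian m V)"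
      by (subst measurable_cong_sets[OF sets_gaussian refl]) measurable
    show "AE x in gaussian m V. norm (u \<bullet> x) \<le> norm (norm u * (1 + (norm x)\<^sup>2))"
      using bound by simp
  qed
qed

text \<open>No integral is computed: reflecting about \<open>m\<close> preserves the law, so the
  integral \<open>I\<close> satisfies \<open>I = 2 * (u \<bullet> m) - I\<close>. Integrability is
  what allows solving for \<open>I\<close>.\<close>

lemma integral_gaussian_inner:
  fixes V :: "real ^ 'n ^ 'n"
  assumes "positive_definite V"
  shows "(\<integral>x. u \<bullet> x \<partial>gaussian m V) = u \<bullet> m"
proof -
  interpret prob_space "gaussian m V"
    by (rule prob_space_gaussian[OF assms])
  have "(\<integral>x. u \<bullet> x \<partial>gaussian m V) = (\<integral>x. u \<bullet> x \<partial>distr (gaussian m V) borel (\<lambda>x. 2 *\<^sub>R m - x))"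
    using gaussian_uminus[OF assms, of m "2 *\<^sub>R m"] by (simp add: scaleR_2)
  also have "\<dots> = (\<integral>x. 2 * (u \<bullet> m) - u \<bullet> x \<partial>gaussian m V)"
    by (simp add: integral_distr inner_diff_right)
  also have "\<dots> = 2 * (u \<bullet> m) - (\<integral>x. u \<bullet> x \<partial>gaussian m V)"
    using integrable_gaussian_inner[OF assms] by (simp add: prob_space[simplified])
  finally show ?thesis by simp
qed

text \<open>Hyperplanes are Lebesgue null and the Gaussian has a density. This is where strictness
  of the convexity comes from.\<close>

lemma AE_gaussian_inner_neq_0:
  assumes "w \<noteq> 0"
  shows "AE x in gaussian m V. w \<bullet> x \<noteq> 0"
proof -
  have "negligible {x. w \<bullet> x = 0}"
    using assms by (intro negligible_hyperplane) simp
  then have "AE x in lebesgue. w \<bullet> x \<noteq> 0"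
    unfolding negligible_iff_null_sets by (auto simp: AE_iff_null_sets intro: AE_I')
  then have "AE x in lborel. w \<bullet> x \<noteq> 0"
    by (simp add: AE_completion_iff)
  then show ?thesis
    unfolding gaussian_def by (subst AE_density) auto
qed

text \<open>The density is strictly positive, so a Gaussian null set is Lebesgue null; a nonempty
  open half-space is not. This is where coercivity comes from.\<close>

lemma not_AE_gaussian_inner_nonneg:
  fixes V :: "real ^ 'n ^ 'n"
  assumes V: "positive_definite V" and "w \<noteq> 0"
  shows "\<not> (AE x in gaussian m V. w \<bullet> x \<ge> 0)"
proof
  assume "AE x in gaussian m V. w \<bullet> x \<ge> 0"
  then have "AE x in lborel. w \<bullet> x \<ge> 0"
    unfolding gaussian_def using det_positive_definite_pos[OF V]
    by (subst (asm) AE_density) auto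
  then have "AE x in lebesgue. w \<bullet> x \<ge> 0"
    by (rule AE_completion)
  then have "{x. w \<bullet> x < 0} \<in> null_sets lebesgue"
    by (subst (asm) AE_iff_null) (auto simp: not_le open_halfspace_lt lborelD)
  moreover have "open {x. w \<bullet> x < 0}"
    by (rule open_halfspace_lt)
  moreover have "- w \<in> {x. w \<bullet> x < 0}"
    using assms(2) by simp
  ultimately show False
    using open_not_negligible negligible_iff_null_sets by blast
qed

section \<open>The data distribution\<close>

lemma measurable_Pair_gaussian:
  "(\<lambda>x. (x, y)) \<in> gaussian m V \<rightarrow>\<^sub>M borel \<Otimes>\<^sub>M (borel :: real measure)"
  by (subst measurable_cong_sets[OF sets_gaussian refl]) measurable

lemma measurable_gaussian_Pair:
  "f \<in> borel \<Otimes>\<^sub>M borel \<rightarrow>\<^sub>M L \<Longrightarrow> (\<lambda>x. f (x, y :: real)) \<in> gaussian m V \<rightarrow>\<^sub>M L"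
  by (rule measurable_compose[OF measurable_Pair_gaussian])

lemma ennreal_half_sum_less_top: "(a + b) / 2 < (top :: ennreal) \<longleftrightarrow> a < top \<and> b < top"
  by (simp add: less_top[symmetric] ennreal_divide_eq_top_iff)

context
  fixes \<mu> :: "real ^ 'd" and \<Sigma> :: "real ^ 'd ^ 'd" and \<kappa> :: real
  assumes pd: "positive_definite (inverse \<kappa> *\<^sub>R \<Sigma>)"
begin

private abbreviation (input) "N m \<equiv> gaussian m (inverse \<kappa> *\<^sub>R \<Sigma>)"

text \<open>The side condition of the rules for \<open>bind\<close>. Every map out of a discrete
  space is measurable, so only membership in the space of subprobabilities is left to check.\<close>

lemma data_dist_kernel:
  "(\<lambda>y. distr (N (if y = 1 then \<mu> else - \<mu>)) (borel \<Otimes>\<^sub>M borel) (\<lambda>x. (x, y)))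
    \<in> measure_pmf (pmf_of_set {0, 1 :: real}) \<rightarrow>\<^sub>M subprob_algebra (borel \<Otimes>\<^sub>M borel)"
proof -
  have "subprob_space (distr (N m) (borel \<Otimes>\<^sub>M borel) (\<lambda>x. (x, y)))" for m and y :: real
    by (intro prob_space_imp_subprob_space prob_space.prob_space_distr prob_space_gaussian[OF pd]
        measurable_Pair_gaussian)
  then show ?thesis
    by (auto simp: space_subprob_algebra)
qed

lemma sets_data_dist [measurable_cong]: "sets (data_dist \<mu> \<Sigma> \<kappa>) = sets (borel \<Otimes>\<^sub>M borel)"
  unfolding data_dist_def by (rule sets_bind) auto

lemma prob_space_data_dist: "prob_space (data_dist \<mu> \<Sigma> \<kappa>)"
  unfolding data_dist_def
proof (rule prob_space.prob_space_bind[OF _ _ data_dist_kernel])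
  show "prob_space (measure_pmf (pmf_of_set {0, 1 :: real}))"
    by (rule prob_space_measure_pmf)
  show "AE y in measure_pmf (pmf_of_set {0, 1 :: real}).
      prob_space (distr (N (if y = 1 then \<mu> else - \<mu>)) (borel \<Otimes>\<^sub>M borel) (\<lambda>x. (x, y)))"
    by (intro AE_I2 prob_space.prob_space_distr prob_space_gaussian[OF pd]
        measurable_Pair_gaussian)
qed

lemma nn_integral_data_dist:
  assumes f: "f \<in> borel_measurable (borel \<Otimes>\<^sub>M borel)"
  shows "(\<integral>\<^sup>+p. f p \<partial>data_dist \<mu> \<Sigma> \<kappa>) =
    ((\<integral>\<^sup>+x. f (x, 1) \<partial>N \<mu>) + (\<integral>\<^sup>+x. f (x, 0) \<partial>N (- \<mu>))) / 2"
proof -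
  have "(\<integral>\<^sup>+p. f p \<partial>data_dist \<mu> \<Sigma> \<kappa>) =
      (\<integral>\<^sup>+y. (\<integral>\<^sup>+p. f p \<partial>distr (N (if y = 1 then \<mu> else - \<mu>)) (borel \<Otimes>\<^sub>M borel) (\<lambda>x. (x, y)))
        \<partial>measure_pmf (pmf_of_set {0, 1}))"
    unfolding data_dist_def by (rule nn_integral_bind[OF f data_dist_kernel])
  also have "\<dots> = (\<integral>\<^sup>+y. (\<integral>\<^sup>+x. f (x, y) \<partial>N (if y = 1 then \<mu> else - \<mu>))
        \<partial>measure_pmf (pmf_of_set {0, 1}))"
    by (intro nn_integral_cong nn_integral_distr measurable_Pair_gaussian) (use f in simp)
  finally show ?thesis
    by (simp add: nn_integral_pmf_of_set add.commute)
qed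

lemma AE_data_dist:
  assumes "Measurable.pred (borel \<Otimes>\<^sub>M borel) Q"
  shows "(AE p in data_dist \<mu> \<Sigma> \<kappa>. Q p) \<longleftrightarrow>
    (AE x in N \<mu>. Q (x, 1)) \<and> (AE x in N (- \<mu>). Q (x, 0))"
proof -
  have "(AE p in data_dist \<mu> \<Sigma> \<kappa>. Q p) \<longleftrightarrow>
      (AE y in measure_pmf (pmf_of_set {0, 1}).
        AE p in distr (N (if y = 1 then \<mu> else - \<mu>)) (borel \<Otimes>\<^sub>M borel) (\<lambda>x. (x, y)). Q p)"
    unfolding data_dist_def by (rule AE_bind[OF data_dist_kernel assms])
  also have "\<dots> \<longleftrightarrow> (AE y in measure_pmf (pmf_of_set {0, 1}).
        AE x in N (if y = 1 then \<mu> else - \<mu>). Q (x, y))"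
    by (subst AE_distr_iff[OF measurable_Pair_gaussian]) (use assms in \<open>simp_all add: pred_def\<close>)
  finally show ?thesis
    by (auto simp: AE_measure_pmf_iff)
qed

text \<open>The weight 1/2 is common to both classes, so invariance of the mixture may be tested on
  the unweighted sum.\<close>

lemma data_dist_eqI:
  assumes h: "h \<in> borel \<Otimes>\<^sub>M borel \<rightarrow>\<^sub>M borel \<Otimes>\<^sub>M borel"
    and "\<And>A. A \<in> sets (borel \<Otimes>\<^sub>M borel) \<Longrightarrow>
      (\<integral>\<^sup>+x. indicator A (h (x, 1)) \<partial>N \<mu>) + (\<integral>\<^sup>+x. indicator A (h (x, 0)) \<partial>N (- \<mu>)) =
      (\<integral>\<^sup>+x. indicator A (x, 1) \<partial>N \<mu>) + (\<integral>\<^sup>+x. indicator A (x, 0) \<partial>N (- \<mu>))"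
  shows "distr (data_dist \<mu> \<Sigma> \<kappa>) (borel \<Otimes>\<^sub>M borel) h = data_dist \<mu> \<Sigma> \<kappa>"
proof (rule measure_eqI)
  show "sets (distr (data_dist \<mu> \<Sigma> \<kappa>) (borel \<Otimes>\<^sub>M borel) h) = sets (data_dist \<mu> \<Sigma> \<kappa>)"
    by (simp add: sets_data_dist)
  fix A assume "A \<in> sets (distr (data_dist \<mu> \<Sigma> \<kappa>) (borel \<Otimes>\<^sub>M borel) h)"
  then have A: "A \<in> sets (borel \<Otimes>\<^sub>M borel)" by simp
  have h': "h \<in> data_dist \<mu> \<Sigma> \<kappa> \<rightarrow>\<^sub>M borel \<Otimes>\<^sub>M borel"
    using h by (simp cong: measurable_cong_sets add: sets_data_dist)
  have ind: "(\<lambda>p. indicator A (h p)) \<in> borel_measurable (borel \<Otimes>\<^sub>M borel)"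
    using h A by measurable
  have "emeasure (distr (data_dist \<mu> \<Sigma> \<kappa>) (borel \<Otimes>\<^sub>M borel) h) A =
      (\<integral>\<^sup>+p. indicator A p \<partial>distr (data_dist \<mu> \<Sigma> \<kappa>) (borel \<Otimes>\<^sub>M borel) h)"
    using A by (subst nn_integral_indicator) auto
  also have "\<dots> = (\<integral>\<^sup>+p. indicator A (h p) \<partial>data_dist \<mu> \<Sigma> \<kappa>)"
    by (rule nn_integral_distr[OF h']) (use A in measurable)
  also have "\<dots> = (\<integral>\<^sup>+p. indicator A p \<partial>data_dist \<mu> \<Sigma> \<kappa>)"
    using A assms(2)[OF A]
    by (subst nn_integral_data_dist[OF ind], subst nn_integral_data_dist) auto
  also have "\<dots> = emeasure (data_dist \<mu> \<Sigma> \<kappa>) A"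
    using A by (subst nn_integral_indicator) (auto simp: sets_data_dist)
  finally show "emeasure (distr (data_dist \<mu> \<Sigma> \<kappa>) (borel \<Otimes>\<^sub>M borel) h) A = emeasure (data_dist \<mu> \<Sigma> \<kappa>) A" .
qed

text \<open>By linearity \<open>M\<close> fixes both class means, and it preserves the covariance,
  so each class law is invariant while the label stays put.\<close>

lemma data_dist_linear:
  fixes M :: "real ^ 'd ^ 'd"
  assumes M: "invertible M" "M *v \<mu> = \<mu>" "M ** (inverse \<kappa> *\<^sub>R \<Sigma>) ** transpose M = inverse \<kappa> *\<^sub>R \<Sigma>"
  shows "distr (data_dist \<mu> \<Sigma> \<kappa>) (borel \<Otimes>\<^sub>M borel) (\<lambda>p. (M *v fst p, snd p)) = data_dist \<mu> \<Sigma> \<kappa>"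
proof (rule data_dist_eqI)
  show "(\<lambda>p. (M *v fst p, snd p)) \<in> borel \<Otimes>\<^sub>M borel \<rightarrow>\<^sub>M borel \<Otimes>\<^sub>M (borel :: real measure)"
    by measurable
  fix A :: "((real ^ 'd) \<times> real) set" assume A: "A \<in> sets (borel \<Otimes>\<^sub>M borel)"
  have "(\<integral>\<^sup>+x. indicator A (M *v x, y) \<partial>N m) = (\<integral>\<^sup>+x. indicator A (x, y) \<partial>N m)"
    if "M *v m = m" for m y
  proof -
    have "(\<integral>\<^sup>+x. indicator A (x, y) \<partial>N m) =
        (\<integral>\<^sup>+x. indicator A (x, y) \<partial>distr (N m) borel (\<lambda>x. 0 + M *v x))"
      unfolding gaussian_affine[OF pd M(1)] M(3) that by simp
    also have "\<dots> = (\<integral>\<^sup>+x. indicator A (0 + M *v x, y) \<partial>N m)"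
      by (rule nn_integral_distr) (use A in measurable)
    finally show ?thesis by simp
  qed
  moreover have "M *v (- \<mu>) = - \<mu>"
    using M(2) by (simp add: vec.neg)
  ultimately show "(\<integral>\<^sup>+x. indicator A (M *v fst (x, 1 :: real), snd (x, 1 :: real)) \<partial>N \<mu>) +
      (\<integral>\<^sup>+x. indicator A (M *v fst (x, 0 :: real), snd (x, 0 :: real)) \<partial>N (- \<mu>)) =
      (\<integral>\<^sup>+x. indicator A (x, 1) \<partial>N \<mu>) + (\<integral>\<^sup>+x. indicator A (x, 0) \<partial>N (- \<mu>))"
    using M(2) by simp
qed

lemma AE_data_dist_label: "AE p in data_dist \<mu> \<Sigma> \<kappa>. snd p = 0 \<or> snd p = 1"
  by (subst AE_data_dist) auto

lemma AE_data_dist_inner_neq_0: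
  assumes "w \<noteq> 0"
  shows "AE p in data_dist \<mu> \<Sigma> \<kappa>. w \<bullet> fst p \<noteq> 0"
  by (subst AE_data_dist) (use assms in \<open>auto intro: AE_gaussian_inner_neq_0\<close>)

lemma integrable_data_dist_norm_sq: "integrable (data_dist \<mu> \<Sigma> \<kappa>) (\<lambda>p. (norm (fst p))\<^sup>2)"
proof (rule integrableI_nonneg)
  have "(\<integral>\<^sup>+x. ennreal ((norm x)\<^sup>2) \<partial>N m) < \<infinity>" for m
    using integrable_gaussian_norm_sq[OF pd, of m] by (simp add: integrable_iff_bounded)
  moreover have "(\<lambda>p. ennreal ((norm (fst p))\<^sup>2)) \<in> borel_measurable
      ((borel :: (real ^ 'd) measure) \<Otimes>\<^sub>M (borel :: real measure))"
    by measurable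
  ultimately show "(\<integral>\<^sup>+p. ennreal ((norm (fst p))\<^sup>2) \<partial>data_dist \<mu> \<Sigma> \<kappa>) < \<infinity>"
    by (subst nn_integral_data_dist) (simp_all add: ennreal_half_sum_less_top)
qed auto

text \<open>The bound is asked only at labels 0 and 1 because other labels form a null set; the
  majorant is integrable by the second moment.\<close>

lemma integrable_data_dist_bound:
  fixes f :: "_ \<Rightarrow> real"
  assumes "f \<in> borel_measurable (borel \<Otimes>\<^sub>M borel)"
    and "\<And>x y. y = 0 \<or> y = 1 \<Longrightarrow> \<bar>f (x, y)\<bar> \<le> C * (1 + (norm x)\<^sup>2)"
  shows "integrable (data_dist \<mu> \<Sigma> \<kappa>) f"
proof (rule Bochner_Integration.integrable_bound)
  interpret prob_space "data_dist \<mu> \<Sigma> \<kappa>"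
    by (rule prob_space_data_dist)
  show "integrable (data_dist \<mu> \<Sigma> \<kappa>) (\<lambda>p. C * (1 + (norm (fst p))\<^sup>2))"
    by (intro integrable_mult_right Bochner_Integration.integrable_add integrable_const
        integrable_data_dist_norm_sq)
  show "f \<in> borel_measurable (data_dist \<mu> \<Sigma> \<kappa>)"
    using assms(1) by (simp cong: measurable_cong_sets add: sets_data_dist)
  show "AE p in data_dist \<mu> \<Sigma> \<kappa>. norm (f p) \<le> norm (C * (1 + (norm (fst p))\<^sup>2))"
    using AE_data_dist_label
  proof eventually_elim
    case (elim p)
    then show ?case
      using assms(2)[of "snd p" "fst p"] by auto
  qed
qed

lemma integral_data_dist:
  fixes f :: "_ \<Rightarrow> real"
  assumes f: "integrable (data_dist \<mu> \<Sigma> \<kappa>) f"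
  shows "(\<integral>p. f p \<partial>data_dist \<mu> \<Sigma> \<kappa>) = ((\<integral>x. f (x, 1) \<partial>N \<mu>) + (\<integral>x. f (x, 0) \<partial>N (- \<mu>))) / 2"
proof -
  have fm: "f \<in> borel_measurable (borel \<Otimes>\<^sub>M borel)"
    using borel_measurable_integrable[OF f] by (simp cong: measurable_cong_sets add: sets_data_dist)
  have meas: "(\<lambda>x. f (x, y)) \<in> borel_measurable (N m)" for m y
    by (rule measurable_gaussian_Pair[OF fm])
  have fin: "(\<integral>\<^sup>+p. ennreal (norm (f p)) \<partial>data_dist \<mu> \<Sigma> \<kappa>) < \<infinity>"
    using f by (simp add: integrable_iff_bounded)
  have "(\<lambda>p. ennreal (norm (f p))) \<in> borel_measurable (borel \<Otimes>\<^sub>M borel)"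
    using fm by measurable
  from fin[unfolded nn_integral_data_dist[OF this]]
  have "(\<integral>\<^sup>+x. ennreal (norm (f (x, 1))) \<partial>N \<mu>) < \<infinity>"
      "(\<integral>\<^sup>+x. ennreal (norm (f (x, 0))) \<partial>N (- \<mu>)) < \<infinity>"
    by (simp_all add: ennreal_half_sum_less_top)
  then have int: "integrable (N \<mu>) (\<lambda>x. f (x, 1))" "integrable (N (- \<mu>)) (\<lambda>x. f (x, 0))"
    using meas by (simp_all add: integrable_iff_bounded)
  \<comment> \<open>Since \<open>ennreal\<close> truncates negative numbers to 0, the values 1 and
    -1 of \<open>s\<close> give the positive and the negative part of the Bochner integral.\<close>
  have pos: "enn2real (\<integral>\<^sup>+p. ennreal (s * f p) \<partial>data_dist \<mu> \<Sigma> \<kappa>) =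
      (enn2real (\<integral>\<^sup>+x. ennreal (s * f (x, 1)) \<partial>N \<mu>) + enn2real (\<integral>\<^sup>+x. ennreal (s * f (x, 0)) \<partial>N (- \<mu>))) / 2"
    for s
  proof -
    have fin: "(\<integral>\<^sup>+x. ennreal (s * f (x, 1)) \<partial>N \<mu>) \<noteq> \<infinity>" "(\<integral>\<^sup>+x. ennreal (s * f (x, 0)) \<partial>N (- \<mu>)) \<noteq> \<infinity>"
      using integrable_mult_right[OF int(1), of s] integrable_mult_right[OF int(2), of s]
      unfolding real_integrable_def by blast+
    obtain a where a: "(\<integral>\<^sup>+x. ennreal (s * f (x, 1)) \<partial>N \<mu>) = ennreal a" "a \<ge> 0"
      by (rule ennreal_cases) (use fin(1) in auto)
    obtain b where b: "(\<integral>\<^sup>+x. ennreal (s * f (x, 0)) \<partial>N (- \<mu>)) = ennreal b" "b \<ge> 0"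
      by (rule ennreal_cases) (use fin(2) in auto)
    note ab = a b
    have "(\<lambda>p. ennreal (s * f p)) \<in> borel_measurable (borel \<Otimes>\<^sub>M borel)"
      using fm by measurable
    from nn_integral_data_dist[OF this]
    have "(\<integral>\<^sup>+p. ennreal (s * f p) \<partial>data_dist \<mu> \<Sigma> \<kappa>) = (ennreal a + ennreal b) / 2"
      unfolding ab .
    also have "\<dots> = ennreal ((a + b) / 2)"
      using ab by (simp add: divide_ennreal flip: ennreal_plus ennreal_numeral)
    finally show ?thesis
      using ab by simp
  qed
  have "(\<integral>p. f p \<partial>data_dist \<mu> \<Sigma> \<kappa>) = enn2real (\<integral>\<^sup>+p. ennreal (1 * f p) \<partial>data_dist \<mu> \<Sigma> \<kappa>) -
      enn2real (\<integral>\<^sup>+p. ennreal (- 1 * f p) \<partial>data_dist \<mu> \<Sigma> \<kappa>)"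
    by (simp add: real_lebesgue_integral_def[OF f])
  also have "\<dots> = ((enn2real (\<integral>\<^sup>+x. ennreal (1 * f (x, 1)) \<partial>N \<mu>) - enn2real (\<integral>\<^sup>+x. ennreal (- 1 * f (x, 1)) \<partial>N \<mu>)) +
      (enn2real (\<integral>\<^sup>+x. ennreal (1 * f (x, 0)) \<partial>N (- \<mu>)) -
       enn2real (\<integral>\<^sup>+x. ennreal (- 1 * f (x, 0)) \<partial>N (- \<mu>)))) / 2"
    unfolding pos by argo
  also have "\<dots> = ((\<integral>x. f (x, 1) \<partial>N \<mu>) + (\<integral>x. f (x, 0) \<partial>N (- \<mu>))) / 2"
    by (simp add: real_lebesgue_integral_def[OF int(1)] real_lebesgue_integral_def[OF int(2)])
  finally show ?thesis .
qed

end

section \<open>The Mixup loss of a fixed sample\<close>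

lemma logistic_loss_minus: "logistic_loss (- z) = logistic_loss z + z"
proof -
  have "1 + exp z = (1 + exp (- z)) * exp z"
    by (simp add: exp_minus field_simps)
  then have "ln (1 + exp z) = ln ((1 + exp (- z)) * exp z)"
    by simp
  also have "\<dots> = ln (1 + exp (- z)) + ln (exp z)"
    by (rule ln_mult_pos) (auto intro: add_pos_pos)
  finally show ?thesis
    by (simp add: logistic_loss_def)
qed

lemma logistic_loss_pos: "logistic_loss z > 0"
  by (simp add: logistic_loss_def ln_gt_zero)

lemma logistic_loss_0: "logistic_loss 0 = ln 2"
  by (simp add: logistic_loss_def)

lemma borel_measurable_logistic_loss [measurable]: "logistic_loss \<in> borel_measurable borel"
  unfolding logistic_loss_def[abs_def] by measurable

text \<open>Says without calculus that the slope lies between -1 and 0. The second bound is the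
  first one at \<open>- b\<close> and \<open>- a\<close>, rewritten with
  \<open>logistic_loss_minus\<close>.\<close>

lemma logistic_loss_mono_diff:
  assumes "a \<le> b"
  shows "logistic_loss b \<le> logistic_loss a" "logistic_loss a \<le> logistic_loss b + (b - a)"
proof -
  show "logistic_loss b \<le> logistic_loss a"
    using assms by (simp add: logistic_loss_def add_pos_pos)
  have "logistic_loss (- a) \<le> logistic_loss (- b)"
    using assms by (simp add: logistic_loss_def add_pos_pos)
  then show "logistic_loss a \<le> logistic_loss b + (b - a)"
    by (simp add: logistic_loss_minus)
qed

text \<open>With \<open>p\<close> and \<open>q\<close> the exponentials of \<open>- a / 2\<close>
  and \<open>- b / 2\<close>, taking exponentials leaves
  \<open>(1 + p * q)\<^sup>2 < (1 + p\<^sup>2) * (1 + q\<^sup>2)\<close>, which is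
  \<open>0 < (p - q)\<^sup>2\<close>.\<close>

lemma logistic_loss_midpoint_less:
  assumes "a \<noteq> b"
  shows "2 * logistic_loss ((a + b) / 2) < logistic_loss a + logistic_loss b"
proof -
  define p q where "p = exp (- a / 2)" and "q = exp (- b / 2)"
  have pq: "p > 0" "q > 0" "p \<noteq> q"
    using assms by (auto simp: p_def q_def)
  have sq: "exp (- a) = p\<^sup>2" "exp (- b) = q\<^sup>2"
    by (simp_all add: p_def q_def power2_eq_square flip: exp_add)
  have m: "exp (- ((a + b) / 2)) = p * q"
    by (simp add: p_def q_def add_divide_distrib flip: exp_add)
  have "0 < (p - q)\<^sup>2"
    using pq by simp
  then have "(1 + p * q)\<^sup>2 < (1 + p\<^sup>2) * (1 + q\<^sup>2)"
    by (simp add: power2_eq_square algebra_simps)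
  moreover have "0 < 1 + p * q"
    using pq by (simp add: add_pos_pos)
  then have "0 < (1 + p * q)\<^sup>2"
    by simp
  ultimately have "ln ((1 + p * q)\<^sup>2) < ln ((1 + p\<^sup>2) * (1 + q\<^sup>2))"
    by (subst ln_less_cancel_iff) linarith+
  also have "\<dots> = ln (1 + p\<^sup>2) + ln (1 + q\<^sup>2)"
    by (rule ln_mult_pos) (auto intro: add_pos_nonneg)
  also have "ln ((1 + p * q)\<^sup>2) = 2 * ln (1 + p * q)"
    using pq by (simp add: ln_realpow add_pos_pos)
  finally show ?thesis
    by (simp add: logistic_loss_def sq m del: minus_add_distrib minus_divide_left)
qed

text \<open>The left side is the logarithm of \<open>2 * cosh (z / 2)\<close>, an even function, so
  nonnegative arguments suffice. There the bound is Hoeffding's lemma for a fair coin, which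
  supplies the constant 1/8.\<close>

lemma logistic_loss_le_quadratic: "logistic_loss z + z / 2 \<le> ln 2 + z\<^sup>2 / 8"
proof -
  have pos: "logistic_loss (- z) - z / 2 \<le> ln 2 + z\<^sup>2 / 8" if "z \<ge> 0" for z
  proof -
    have "ln (1 + exp z) = ln (2 * (1 + 1 / 2 * (exp z - 1)))"
      by (rule arg_cong[of _ _ ln]) (simp add: field_simps)
    also have "\<dots> = ln 2 + ln (1 + 1 / 2 * (exp z - 1))"
    proof (rule ln_mult_pos)
      have "1 + 1 / 2 * (exp z - 1) = 1 / 2 + exp z / 2"
        by (simp add: field_simps)
      then show "0 < 1 + 1 / 2 * (exp z - 1)"
        by (simp add: add_pos_pos)
    qed simp
    finally show ?thesis
      using Hoeffdings_lemma_aux[OF that, of "1 / 2"] by (simp add: logistic_loss_def)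
  qed
  show ?thesis
  proof (cases "z \<ge> 0")
    case True
    then show ?thesis
      using pos[of z] by (simp add: logistic_loss_minus)
  next
    case False
    then show ?thesis
      using pos[of "- z"] by simp
  qed
qed

text \<open>The tangent at 0, read off the midpoint inequality for \<open>z\<close> and
  \<open>- z\<close>.\<close>

lemma logistic_loss_ge_linear: "ln 2 - z / 2 \<le> logistic_loss z"
  using logistic_loss_midpoint_less[of z "- z"] logistic_loss_0
  by (cases "z = 0") (simp_all add: logistic_loss_minus)

text \<open>The binary cross-entropy between a soft label \<open>y\<close> and the sigmoid of
  \<open>z\<close>.\<close>

definition soft_loss :: "real \<Rightarrow> real \<Rightarrow> real" where
  "soft_loss y z = y * logistic_loss z + (1 - y) * logistic_loss (- z)"

lemma soft_loss_eq: "soft_loss y z = logistic_loss z + (1 - y) * z"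
  by (simp add: soft_loss_def logistic_loss_minus algebra_simps)

lemma soft_loss_nonneg: "y \<in> {0..1} \<Longrightarrow> soft_loss y z \<ge> 0"
  using less_imp_le[OF logistic_loss_pos] by (simp add: soft_loss_def)

text \<open>From \<open>a\<close> to \<open>b\<close> the logistic part falls by at most
  \<open>b - a\<close> and the linear part rises by at most \<open>b - a\<close>, so the opposite
  signs keep the total within that range.\<close>

lemma soft_loss_Lipschitz:
  assumes "y \<in> {0..1}"
  shows "\<bar>soft_loss y a - soft_loss y b\<bar> \<le> \<bar>a - b\<bar>"
proof -
  have *: "\<bar>soft_loss y a - soft_loss y b\<bar> \<le> b - a" if "a \<le> b" for a b
  proof -
    have "(1 - y) * (b - a) \<le> b - a" "(1 - y) * (b - a) \<ge> 0"
      using assms that by (auto simp: mult_left_le_one_le)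
    then show ?thesis
      using logistic_loss_mono_diff[OF that] by (simp add: soft_loss_eq algebra_simps abs_le_iff)
  qed
  show ?thesis
    using *[of a b] *[of b a] by (cases "a \<le> b") auto
qed

lemma soft_loss_midpoint_less:
  "a \<noteq> b \<Longrightarrow> 2 * soft_loss y ((a + b) / 2) < soft_loss y a + soft_loss y b"
  using logistic_loss_midpoint_less[of a b] by (simp add: soft_loss_eq field_simps)

lemma soft_loss_midpoint_le: "2 * soft_loss y ((a + b) / 2) \<le> soft_loss y a + soft_loss y b"
  by (cases "a = b") (simp_all add: less_imp_le[OF soft_loss_midpoint_less])

lemma soft_loss_ge_linear: "ln 2 - (y - 1 / 2) * z \<le> soft_loss y z"
  using logistic_loss_ge_linear[of z] by (simp add: soft_loss_eq algebra_simps)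

lemma soft_loss_le_quadratic: "soft_loss y z \<le> ln 2 + z\<^sup>2 / 8 - (y - 1 / 2) * z"
  using logistic_loss_le_quadratic[of z] by (simp add: soft_loss_eq algebra_simps)

text \<open>Positivity of the logistic loss at \<open>z\<close> and at \<open>- z\<close>, the
  latter being \<open>logistic_loss z + z\<close>.\<close>

lemma soft_loss_ge_hinge:
  assumes "y = 0 \<or> y = 1"
  shows "max 0 ((1 - 2 * y) * z) \<le> soft_loss y z"
  using assms less_imp_le[OF logistic_loss_pos[of z]] less_imp_le[OF logistic_loss_pos[of "- z"]]
  by (auto simp: soft_loss_eq logistic_loss_minus)

section \<open>Pointwise bounds on the loss of one draw\<close>

lemma mixup_loss_soft_loss:
  "mixup_loss g n S lam w = 1 / (real n)\<^sup>2 *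
    (\<Sum>i = 1..n. \<Sum>j = 1..n. soft_loss (mix_label S lam i j) (w \<bullet> mix_point g S lam i j))"
  by (simp add: mixup_loss_def soft_loss_def)

text \<open>The almost sure event that keeps measure theory out of the pointwise bounds. Labels are
  0 or 1 only up to a null set; the condition on the coefficients holds on the whole sample
  space.\<close>

definition admissible ::
    "(real \<Rightarrow> real) \<Rightarrow> nat \<Rightarrow> (nat \<Rightarrow> (real ^ 'd) \<times> real) \<Rightarrow> (nat \<times> nat \<Rightarrow> real) \<Rightarrow> bool" where
  "admissible g n S lam \<longleftrightarrow> (\<forall>i\<in>{1..n}. snd (S i) = 0 \<or> snd (S i) = 1) \<and>
    (\<forall>i\<in>{1..n}. \<forall>j\<in>{1..n}. lam (i, j) \<in> {0..1} \<and> g (lam (i, j)) \<in> {0..1})"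

text \<open>An integrable majorant; the summand 1 makes it dominate both the norm and the squared
  norm of every mixed point.\<close>

definition sample_bound :: "nat \<Rightarrow> (nat \<Rightarrow> (real ^ 'd) \<times> real) \<Rightarrow> real" where
  "sample_bound n S = 1 + (\<Sum>i = 1..n. (norm (fst (S i)))\<^sup>2)"

text \<open>Minus the directional derivative of the loss at the origin along \<open>w\<close>: the
  derivative of \<open>soft_loss y\<close> at 0 is \<open>1 / 2 - y\<close>.\<close>

definition mixup_slope ::
    "(real \<Rightarrow> real) \<Rightarrow> nat \<Rightarrow> (nat \<Rightarrow> (real ^ 'd) \<times> real) \<Rightarrow> (nat \<times> nat \<Rightarrow> real)
      \<Rightarrow> real ^ 'd \<Rightarrow> real" where
  "mixup_slope g n S lam w = 1 / (real n)\<^sup>2 *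
    (\<Sum>i = 1..n. \<Sum>j = 1..n. (mix_label S lam i j - 1 / 2) * (w \<bullet> mix_point g S lam i j))"

lemma norm_convex_combination_le_max:
  fixes x y :: "'a :: real_normed_vector"
  assumes "t \<in> {0..1}"
  shows "norm (t *\<^sub>R x + (1 - t) *\<^sub>R y) \<le> max (norm x) (norm y)"
proof -
  have "norm (t *\<^sub>R x + (1 - t) *\<^sub>R y) \<le> t * norm x + (1 - t) * norm y"
    using norm_triangle_ineq[of "t *\<^sub>R x" "(1 - t) *\<^sub>R y"] assms by simp
  also have "\<dots> \<le> max (norm x) (norm y)"
    using assms by (intro convex_bound_le) auto
  finally show ?thesis .
qed

lemma average_le:
  fixes a b :: "nat \<Rightarrow> nat \<Rightarrow> real"
  assumes "\<And>i j. i \<in> {1..n} \<Longrightarrow> j \<in> {1..n} \<Longrightarrow> a i j \<le> b i j"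
  shows "1 / (real n)\<^sup>2 * (\<Sum>i = 1..n. \<Sum>j = 1..n. a i j) \<le> 1 / (real n)\<^sup>2 * (\<Sum>i = 1..n. \<Sum>j = 1..n. b i j)"
  using assms by (intro mult_left_mono sum_mono) auto

lemma average_const:
  assumes "n \<ge> 1"
  shows "1 / (real n)\<^sup>2 * (\<Sum>i = 1..n. \<Sum>j = 1..n. c) = c"
  using assms by (simp add: power2_eq_square)

context
  fixes g :: "real \<Rightarrow> real" and n :: nat and S :: "nat \<Rightarrow> (real ^ 'd) \<times> real" and lam
  assumes adm: "admissible g n S lam"
begin

lemma mix_label_range:
  assumes "i \<in> {1..n}" "j \<in> {1..n}"
  shows "mix_label S lam i j \<in> {0..1}"
proof -
  have "lam (i, j) \<in> {0..1}" "snd (S i) = 0 \<or> snd (S i) = 1" "snd (S j) = 0 \<or> snd (S j) = 1"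
    using adm assms unfolding admissible_def by blast+
  then show ?thesis
    by (auto simp: mix_label_def)
qed

lemma norm_mix_point_le:
  assumes "i \<in> {1..n}" "j \<in> {1..n}"
  shows "norm (mix_point g S lam i j) \<le> sample_bound n S" "(norm (mix_point g S lam i j))\<^sup>2 \<le> sample_bound n S"
proof -
  define m where "m = max (norm (fst (S i))) (norm (fst (S j)))"
  have "norm (mix_point g S lam i j) \<le> m"
    unfolding mix_point_def m_def
    using adm assms by (intro norm_convex_combination_le_max) (auto simp: admissible_def)
  moreover have m2: "1 + m\<^sup>2 \<le> sample_bound n S"
  proof -
    have "(norm (fst (S k)))\<^sup>2 \<le> (\<Sum>i = 1..n. (norm (fst (S i)))\<^sup>2)" if "k \<in> {1..n}" for k
      using that by (intro member_le_sum) auto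
    then show ?thesis
      using assms unfolding sample_bound_def m_def max_def by auto
  qed
  moreover have "m \<le> 1 + m\<^sup>2"
    by (rule le_one_plus_square)
  ultimately show "norm (mix_point g S lam i j) \<le> sample_bound n S"
    by linarith
  have "(norm (mix_point g S lam i j))\<^sup>2 \<le> m\<^sup>2"
    using \<open>norm (mix_point g S lam i j) \<le> m\<close> by (rule power_mono) simp
  then show "(norm (mix_point g S lam i j))\<^sup>2 \<le> sample_bound n S"
    using m2 by linarith
qed

text \<open>Used twice: in expectation it gives continuity, and for \<open>w = 0\<close> it
  dominates the loss by an integrable function.\<close>

lemma mixup_loss_Lipschitz:
  assumes "n \<ge> 1"
  shows "\<bar>mixup_loss g n S lam v - mixup_loss g n S lam w\<bar> \<le> norm (v - w) * sample_bound n S"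
proof -
  let ?t = "\<lambda>w i j. soft_loss (mix_label S lam i j) (w \<bullet> mix_point g S lam i j)"
  \<comment> \<open>One-sided and generic in \<open>v\<close> and \<open>w\<close>, so that
    inequalities can simply be averaged; exchanging \<open>v\<close> and \<open>w\<close> at the end
    restores the absolute value.\<close>
  have "?t v i j \<le> ?t w i j + norm (v - w) * sample_bound n S"
    if "i \<in> {1..n}" "j \<in> {1..n}" for i j v w
  proof -
    have "\<bar>?t v i j - ?t w i j\<bar> \<le> \<bar>v \<bullet> mix_point g S lam i j - w \<bullet> mix_point g S lam i j\<bar>"
      by (rule soft_loss_Lipschitz[OF mix_label_range[OF that]])
    also have "\<dots> = \<bar>(v - w) \<bullet> mix_point g S lam i j\<bar>"
      by (simp add: inner_diff_left)
    also have "\<dots> \<le> norm (v - w) * norm (mix_point g S lam i j)"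
      by (rule Cauchy_Schwarz_ineq2)
    also have "\<dots> \<le> norm (v - w) * sample_bound n S"
      by (intro mult_left_mono norm_mix_point_le that) simp
    finally show ?thesis by linarith
  qed
  then have "mixup_loss g n S lam v \<le> 1 / (real n)\<^sup>2 *
      (\<Sum>i = 1..n. \<Sum>j = 1..n. ?t w i j + norm (v - w) * sample_bound n S)" for v w
    unfolding mixup_loss_soft_loss by (rule average_le)
  then have "mixup_loss g n S lam v \<le> mixup_loss g n S lam w + norm (v - w) * sample_bound n S" for v w
    unfolding sum.distrib distrib_left average_const[OF assms] mixup_loss_soft_loss .
  from this[of v w] this[of w v] show ?thesis
    by (simp add: abs_le_iff norm_minus_commute)
qed

lemma mixup_loss_ge_hinge:
  assumes "n \<ge> 1"
  shows "1 / (real n)\<^sup>2 * max 0 ((1 - 2 * snd (S 1)) * (w \<bullet> fst (S 1))) \<le> mixup_loss g n S lam w"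
proof -
  let ?t = "\<lambda>i j. soft_loss (mix_label S lam i j) (w \<bullet> mix_point g S lam i j)"
  have nonneg: "?t i j \<ge> 0" if "i \<in> {1..n}" "j \<in> {1..n}" for i j
    by (rule soft_loss_nonneg[OF mix_label_range[OF that]])
  have one: "1 \<in> {1..n}" using assms by simp
  have "mix_label S lam 1 1 = snd (S 1)" "mix_point g S lam 1 1 = fst (S 1)"
    by (simp_all add: mix_label_def mix_point_def algebra_simps)
  moreover have "snd (S 1) = 0 \<or> snd (S 1) = 1"
    using adm one unfolding admissible_def by blast
  ultimately have "max 0 ((1 - 2 * snd (S 1)) * (w \<bullet> fst (S 1))) \<le> ?t 1 1"
    by (simp only: soft_loss_ge_hinge)
  also have "\<dots> \<le> (\<Sum>j = 1..n. ?t 1 j)"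
    using one nonneg by (intro member_le_sum) auto
  also have "\<dots> \<le> (\<Sum>i = 1..n. \<Sum>j = 1..n. ?t i j)"
    using one nonneg by (intro member_le_sum[of 1 _ "\<lambda>i. \<Sum>j = 1..n. ?t i j"] sum_nonneg) auto
  finally show ?thesis
    unfolding mixup_loss_soft_loss by (rule mult_left_mono) simp
qed

text \<open>Each summand is midpoint convex, and strictness in the summand \<open>i = j = 1\<close>
  is enough.\<close>

lemma mixup_loss_midpoint_less:
  assumes "n \<ge> 1" "v \<bullet> fst (S 1) \<noteq> w \<bullet> fst (S 1)"
  shows "2 * mixup_loss g n S lam ((1 / 2) *\<^sub>R (v + w)) < mixup_loss g n S lam v + mixup_loss g n S lam w"
proof -
  let ?t = "\<lambda>w i j. soft_loss (mix_label S lam i j) (w \<bullet> mix_point g S lam i j)"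
  have mid: "((1 / 2) *\<^sub>R (v + w)) \<bullet> x = (v \<bullet> x + w \<bullet> x) / 2" for x
    by (simp add: inner_add_left)
  have le: "2 * ?t ((1 / 2) *\<^sub>R (v + w)) i j \<le> ?t v i j + ?t w i j" for i j
    unfolding mid by (rule soft_loss_midpoint_le)
  have one: "1 \<in> {1..n}" using assms by simp
  have "mix_point g S lam 1 1 = fst (S 1)"
    by (simp add: mix_point_def algebra_simps)
  then have less: "2 * ?t ((1 / 2) *\<^sub>R (v + w)) 1 1 < ?t v 1 1 + ?t w 1 1"
    unfolding mid using assms(2) by (intro soft_loss_midpoint_less) simp
  have "(\<Sum>i = 1..n. \<Sum>j = 1..n. 2 * ?t ((1 / 2) *\<^sub>R (v + w)) i j) <
      (\<Sum>i = 1..n. \<Sum>j = 1..n. ?t v i j + ?t w i j)"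
  proof (rule sum_strict_mono_ex1)
    show "\<forall>i\<in>{1..n}. (\<Sum>j = 1..n. 2 * ?t ((1 / 2) *\<^sub>R (v + w)) i j) \<le> (\<Sum>j = 1..n. ?t v i j + ?t w i j)"
      using le by (intro ballI sum_mono)
    show "\<exists>i\<in>{1..n}. (\<Sum>j = 1..n. 2 * ?t ((1 / 2) *\<^sub>R (v + w)) i j) < (\<Sum>j = 1..n. ?t v i j + ?t w i j)"
      using le less one by (intro bexI[of _ 1] sum_strict_mono_ex1) auto
  qed simp
  moreover have "0 < 1 / (real n)\<^sup>2" using assms(1) by simp
  ultimately have "1 / (real n)\<^sup>2 * (\<Sum>i = 1..n. \<Sum>j = 1..n. 2 * ?t ((1 / 2) *\<^sub>R (v + w)) i j) <
      1 / (real n)\<^sup>2 * (\<Sum>i = 1..n. \<Sum>j = 1..n. ?t v i j + ?t w i j)"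
    by (rule mult_strict_left_mono)
  then show ?thesis
    unfolding mixup_loss_soft_loss by (simp add: sum.distrib distrib_left flip: sum_distrib_left)
qed

text \<open>Together with \<open>mixup_loss_le_slope\<close> this encloses the loss around its
  first-order expansion at the origin, in place of a derivative of the expectation.\<close>

lemma mixup_loss_ge_slope:
  assumes "n \<ge> 1"
  shows "ln 2 - mixup_slope g n S lam w \<le> mixup_loss g n S lam w"
proof -
  have "1 / (real n)\<^sup>2 * (\<Sum>i = 1..n. \<Sum>j = 1..n. ln 2 - (mix_label S lam i j - 1 / 2) * (w \<bullet> mix_point g S lam i j))
      \<le> mixup_loss g n S lam w"
    unfolding mixup_loss_soft_loss by (intro average_le soft_loss_ge_linear)
  then show ?thesis
    unfolding sum_subtractf right_diff_distrib[of "1 / (real n)\<^sup>2"] average_const[OF assms] mixup_slope_def .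
qed

lemma mixup_loss_le_slope:
  assumes "n \<ge> 1"
  shows "mixup_loss g n S lam w \<le> ln 2 + (norm w)\<^sup>2 * sample_bound n S / 8 - mixup_slope g n S lam w"
proof -
  have "soft_loss (mix_label S lam i j) (w \<bullet> mix_point g S lam i j) \<le>
      (ln 2 + (norm w)\<^sup>2 * sample_bound n S / 8) - (mix_label S lam i j - 1 / 2) * (w \<bullet> mix_point g S lam i j)"
    if "i \<in> {1..n}" "j \<in> {1..n}" for i j
  proof -
    have "(w \<bullet> mix_point g S lam i j)\<^sup>2 \<le> (norm w * norm (mix_point g S lam i j))\<^sup>2"
      using Cauchy_Schwarz_ineq2[of w "mix_point g S lam i j"] by (subst abs_le_square_iff[symmetric]) simp
    also have "\<dots> \<le> (norm w)\<^sup>2 * sample_bound n S"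
      unfolding power_mult_distrib by (intro mult_left_mono norm_mix_point_le that) simp
    finally show ?thesis
      using soft_loss_le_quadratic[of "mix_label S lam i j" "w \<bullet> mix_point g S lam i j"] by linarith
  qed
  then have "mixup_loss g n S lam w \<le> 1 / (real n)\<^sup>2 * (\<Sum>i = 1..n. \<Sum>j = 1..n.
      (ln 2 + (norm w)\<^sup>2 * sample_bound n S / 8) - (mix_label S lam i j - 1 / 2) * (w \<bullet> mix_point g S lam i j))"
    unfolding mixup_loss_soft_loss by (rule average_le)
  then show ?thesis
    unfolding sum_subtractf right_diff_distrib[of "1 / (real n)\<^sup>2"] average_const[OF assms] mixup_slope_def .
qed

lemma abs_mixup_slope_le:
  assumes "n \<ge> 1"
  shows "\<bar>mixup_slope g n S lam w\<bar> \<le> norm w * sample_bound n S"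
proof -
  have "\<bar>(mix_label S lam i j - 1 / 2) * (w \<bullet> mix_point g S lam i j)\<bar> \<le> norm w * sample_bound n S"
    if "i \<in> {1..n}" "j \<in> {1..n}" for i j
  proof -
    have "\<bar>mix_label S lam i j - 1 / 2\<bar> \<le> 1"
      using mix_label_range[OF that] by (auto simp: abs_le_iff)
    moreover have "\<bar>w \<bullet> mix_point g S lam i j\<bar> \<le> norm w * sample_bound n S"
      using Cauchy_Schwarz_ineq2[of w "mix_point g S lam i j"]
        mult_left_mono[OF norm_mix_point_le(1)[OF that], of "norm w"] by simp
    ultimately have "\<bar>mix_label S lam i j - 1 / 2\<bar> * \<bar>w \<bullet> mix_point g S lam i j\<bar> \<le> 1 * (norm w * sample_bound n S)"
      by (intro mult_mono) auto
    then show ?thesis by (simp add: abs_mult)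
  qed
  then have "(\<Sum>i = 1..n. \<Sum>j = 1..n. \<bar>(mix_label S lam i j - 1 / 2) * (w \<bullet> mix_point g S lam i j)\<bar>)
      \<le> (\<Sum>i = 1..n. \<Sum>j = 1..n. norm w * sample_bound n S)"
    by (intro sum_mono) auto
  moreover have "\<bar>\<Sum>i = 1..n. \<Sum>j = 1..n. (mix_label S lam i j - 1 / 2) * (w \<bullet> mix_point g S lam i j)\<bar> \<le>
      (\<Sum>i = 1..n. \<Sum>j = 1..n. \<bar>(mix_label S lam i j - 1 / 2) * (w \<bullet> mix_point g S lam i j)\<bar>)"
    by (intro order.trans[OF sum_abs] sum_mono sum_abs)
  ultimately have "1 / (real n)\<^sup>2 * \<bar>\<Sum>i = 1..n. \<Sum>j = 1..n. (mix_label S lam i j - 1 / 2) * (w \<bullet> mix_point g S lam i j)\<bar>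
      \<le> 1 / (real n)\<^sup>2 * (\<Sum>i = 1..n. \<Sum>j = 1..n. norm w * sample_bound n S)"
    by (intro mult_left_mono) auto
  then show ?thesis
    unfolding average_const[OF assms] by (simp add: mixup_slope_def abs_mult)
qed

end

lemma mixup_loss_0: "n \<ge> 1 \<Longrightarrow> mixup_loss g n S lam 0 = ln 2"
  by (simp add: mixup_loss_soft_loss soft_loss_eq logistic_loss_0 power2_eq_square)

lemma mixup_slope_scaleR: "mixup_slope g n S lam (c *\<^sub>R w) = c * mixup_slope g n S lam w"
  by (simp add: mixup_slope_def sum_distrib_left mult_ac)

text \<open>Mixing is linear in the points, so \<open>M\<close> passes through it and moves to
  \<open>w\<close> as its adjoint. \<open>compose\<close> keeps the transformed sample extensional,
  as elements of the product space must be.\<close>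

lemma mixup_loss_linear_image:
  fixes M :: "real ^ 'd ^ 'd"
  shows "mixup_loss g n (compose {1..n} (\<lambda>p. (M *v fst p, snd p)) S) lam w =
    mixup_loss g n S lam (transpose M *v w)"
proof -
  let ?S = "compose {1..n} (\<lambda>p. (M *v fst p, snd p)) S"
  have "mix_label ?S lam i j = mix_label S lam i j" "mix_point g ?S lam i j = M *v mix_point g S lam i j"
    if "i \<in> {1..n}" "j \<in> {1..n}" for i j
    using that by (simp_all add: compose_def mix_label_def mix_point_def matrix_vector_right_distrib
        matrix_vector_mult_scaleR)
  moreover have "w \<bullet> (M *v x) = (transpose M *v w) \<bullet> x" for x
    by (simp add: dot_lmul_matrix[symmetric])
  ultimately show ?thesis
    unfolding mixup_loss_soft_loss by simp
qed

section \<open>Reflections and strictly convex minimization\<close>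

lemma positive_definite_inner_commute:
  assumes "positive_definite A"
  shows "x \<bullet> (A *v y) = (A *v x) \<bullet> y"
  using assms by (metis dot_lmul_matrix positive_definite_def transpose_matrix_vector)

text \<open>The transpose of \<open>M\<close> is the reflection fixing \<open>u = A\<^sup>-\<^sup>1 m\<close> and negating the
  orthogonal complement of \<open>m\<close>.\<close>
lemma positive_definite_reflection:
  fixes A :: "real ^ 'n ^ 'n" and u m :: "real ^ 'n"
  assumes A: "positive_definite A" and u: "A *v u = m" and m: "m \<noteq> 0"
  obtains M where "invertible M" "M *v m = m" "M ** A ** transpose M = A"
    "\<And>w. transpose M *v w = (2 * (w \<bullet> m) / (u \<bullet> m)) *\<^sub>R u - w"
proof -
  have "u \<noteq> 0" using u m by auto
  then have um: "u \<bullet> m > 0"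
    using A by (auto simp: positive_definite_def simp flip: u)
  \<comment> \<open>In the inner product of the inverse of \<open>A\<close>,
    \<open>u \<bullet> x\<close> is the product of \<open>m\<close> and \<open>x\<close>; so
    \<open>f\<close> is the reflection in the line of \<open>m\<close>, an isometric involution
    there, which is why \<open>M ** A ** transpose M = A\<close>.\<close>
  define f where "f x = (2 * (u \<bullet> x) / (u \<bullet> m)) *\<^sub>R m - x" for x
  have f: "linear f"
    by (rule linearI) (simp_all add: f_def inner_add_right add_divide_distrib distrib_left
        scaleR_add_left scaleR_diff_right)
  define M where "M = matrix f"
  have M: "M *v x = f x" for x
    unfolding M_def using f by (simp add: matrix_works)
  have T: "transpose M *v w = (2 * (w \<bullet> m) / (u \<bullet> m)) *\<^sub>R u - w" for w
  proof -
    have "(transpose M *v w) \<bullet> x = ((2 * (w \<bullet> m) / (u \<bullet> m)) *\<^sub>R u - w) \<bullet> x" for x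
    proof -
      have "(transpose M *v w) \<bullet> x = w \<bullet> f x"
        by (simp add: dot_lmul_matrix flip: M)
      also have "\<dots> = ((2 * (w \<bullet> m) / (u \<bullet> m)) *\<^sub>R u - w) \<bullet> x"
        by (simp add: f_def inner_diff_left inner_diff_right)
      finally show ?thesis .
    qed
    then show ?thesis
      using vector_eq_rdot by blast
  qed
  have Mm: "M *v m = m"
    using um by (simp add: M f_def scaleR_2 flip: scaleR_add_left)
  have "M *v (M *v x) = x" for x
    using um by (simp add: M f_def inner_diff_right)
  then have "M ** M = mat 1"
    by (simp add: matrix_eq matrix_vector_mul_assoc[symmetric])
  then have "invertible M"
    unfolding invertible_def by blast
  moreover have "M ** A ** transpose M = A"
  proof -
    have "M *v (A *v (transpose M *v w)) = A *v w" for w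
    proof -
      have "u \<bullet> (A *v w) = w \<bullet> m"
        using positive_definite_inner_commute[OF A, of u w] u by (simp add: inner_commute)
      moreover have "A *v (transpose M *v w) = (2 * (w \<bullet> m) / (u \<bullet> m)) *\<^sub>R m - A *v w"
        unfolding T by (simp add: matrix_vector_mult_diff_distrib matrix_vector_mult_scaleR u)
      ultimately show ?thesis
        using um by (simp add: M f_def inner_diff_right)
    qed
    then show ?thesis
      by (simp add: matrix_eq matrix_vector_mul_assoc[symmetric])
  qed
  ultimately show thesis
    using that Mm T by blast
qed

text \<open>The radius is chosen with \<open>\<delta> * r = \<bar>L 0\<bar>\<close>, so outside the
  ball coercivity puts \<open>L\<close> above \<open>L 0\<close>, and compactness of the ball yields
  a minimizer. Two distinct minimizers would be beaten by their midpoint.\<close>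

lemma ex1_minimizer:
  fixes L :: "'a :: euclidean_space \<Rightarrow> real"
  assumes cont: "continuous_on UNIV L" and "\<delta> > 0" and coercive: "\<And>w. \<delta> * norm w \<le> L w"
    and strict: "\<And>v w. v \<noteq> w \<Longrightarrow> 2 * L ((1 / 2) *\<^sub>R (v + w)) < L v + L w"
  shows "\<exists>!w. is_arg_min L (\<lambda>_. True) w"
proof -
  define r where "r = \<bar>L 0\<bar> / \<delta>"
  have "r \<ge> 0" using \<open>\<delta> > 0\<close> by (simp add: r_def)
  have "\<exists>w\<in>cball 0 r. \<forall>v\<in>cball 0 r. L w \<le> L v"
    using \<open>r \<ge> 0\<close> by (intro continuous_attains_inf continuous_on_subset[OF cont]) auto
  then obtain w where w: "\<And>v. v \<in> cball 0 r \<Longrightarrow> L w \<le> L v"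
    by blast
  have min: "L w \<le> L v" for v
  proof (cases "norm v \<le> r")
    case True
    then show ?thesis using w by simp
  next
    case False
    have "L w \<le> L 0" using w \<open>r \<ge> 0\<close> by simp
    also have "L 0 \<le> \<delta> * r" using \<open>\<delta> > 0\<close> by (simp add: r_def)
    also have "\<dots> \<le> \<delta> * norm v" using False \<open>\<delta> > 0\<close> by simp
    also have "\<dots> \<le> L v" by (rule coercive)
    finally show ?thesis .
  qed
  show ?thesis
  proof (rule ex1I[of _ w])
    show "is_arg_min L (\<lambda>_. True) w"
      using min by (simp add: is_arg_min_linorder)
    fix v assume "is_arg_min L (\<lambda>_. True) v"
    then have "L v \<le> L w" "L v \<le> L ((1 / 2) *\<^sub>R (v + w))"
      by (simp_all add: is_arg_min_linorder)
    with strict[of v w] min[of "(1 / 2) *\<^sub>R (v + w)"] show "v = w"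
      by (cases "v = w") auto
  qed
qed

section \<open>The expected Mixup loss\<close>

context
  fixes \<mu> :: "real ^ 'd" and \<Sigma> :: "real ^ 'd ^ 'd" and \<kappa> :: real
    and \<Lambda> :: "real measure" and g :: "real \<Rightarrow> real" and n :: nat
  assumes pd: "positive_definite (inverse \<kappa> *\<^sub>R \<Sigma>)" and params: "mixup_params \<Lambda> g" and n: "n \<ge> 1"
begin

private abbreviation (input) "P \<equiv> data_dist \<mu> \<Sigma> \<kappa>"
private abbreviation (input) "PS \<equiv> Pi\<^sub>M {1..n} (\<lambda>_. data_dist \<mu> \<Sigma> \<kappa>)"
private abbreviation (input) "P\<Lambda> \<equiv> Pi\<^sub>M ({1..n} \<times> {1..n}) (\<lambda>_. \<Lambda>)"
private abbreviation (input) "\<Omega> \<equiv> mixup_space \<mu> \<Sigma> \<Lambda> n \<kappa>"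
private abbreviation (input) "loss w \<omega> \<equiv> mixup_loss g n (fst \<omega>) (snd \<omega>) w"

section \<open>Marginals, measurability and integrability on the joint space\<close>

lemma prob_space_mixing: "prob_space \<Lambda>"
  using params by (simp add: mixup_params_def)

lemma space_mixing: "space \<Lambda> = {0..1}"
proof -
  have "space \<Lambda> = space (restrict_space borel {0..1 :: real})"
    using params by (intro sets_eq_imp_space_eq) (simp add: mixup_params_def)
  then show ?thesis by (simp add: space_restrict_space)
qed

lemma measurable_mixing_ident: "(\<lambda>x. x) \<in> \<Lambda> \<rightarrow>\<^sub>M borel"
proof -
  have "sets \<Lambda> = sets (restrict_space borel {0..1 :: real})"
    using params by (simp add: mixup_params_def)
  then show ?thesis
    by (subst measurable_cong_sets[OF _ refl]) (auto intro: measurable_restrict_space1)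
qed

lemma measurable_mixing_g: "g \<in> \<Lambda> \<rightarrow>\<^sub>M borel"
  using params by (simp add: mixup_params_def)

lemma prob_space_samples: "prob_space PS"
  by (intro prob_space_PiM prob_space_data_dist[OF pd])

lemma prob_space_coefficients: "prob_space P\<Lambda>"
  by (intro prob_space_PiM prob_space_mixing)

lemma prob_space_mixup_space: "prob_space \<Omega>"
  unfolding mixup_space_def by (intro prob_space_pair prob_space_samples prob_space_coefficients)

lemma measurable_sample:
  assumes "i \<in> {1..n}"
  shows "(\<lambda>\<omega>. fst \<omega> i) \<in> \<Omega> \<rightarrow>\<^sub>M P"
  unfolding mixup_space_def
  by (rule measurable_compose[OF measurable_fst measurable_component_singleton[OF assms]])

lemma measurable_coefficient:
  assumes "i \<in> {1..n}" "j \<in> {1..n}"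
  shows "(\<lambda>\<omega>. snd \<omega> (i, j)) \<in> \<Omega> \<rightarrow>\<^sub>M \<Lambda>"
  unfolding mixup_space_def
  by (rule measurable_compose[OF measurable_snd measurable_component_singleton]) (use assms in simp)

text \<open>Through this marginal, facts about one data point carry over to the joint space.\<close>

lemma distr_sample:
  assumes "i \<in> {1..n}"
  shows "distr \<Omega> P (\<lambda>\<omega>. fst \<omega> i) = P"
proof -
  have "distr \<Omega> P (\<lambda>\<omega>. fst \<omega> i) = distr (distr (PS \<Otimes>\<^sub>M P\<Lambda>) PS fst) P (\<lambda>S. S i)"
    unfolding mixup_space_def
    by (subst distr_distr[OF measurable_component_singleton[OF assms] measurable_fst]) (simp add: comp_def)
  also have "\<dots> = distr PS P (\<lambda>S. S i)"
    by (subst prob_space.distr_pair_fst[OF prob_space_coefficients]) simp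
  also have "\<dots> = P"
    by (rule distr_PiM_component[OF prob_space_data_dist[OF pd] assms])
  finally show ?thesis .
qed

lemma AE_sample:
  assumes "AE p in P. Q p" "i \<in> {1..n}"
  shows "AE \<omega> in \<Omega>. Q (fst \<omega> i)"
proof (rule AE_distrD[OF measurable_sample[OF assms(2)]])
  show "AE p in distr \<Omega> P (\<lambda>\<omega>. fst \<omega> i). Q p"
    unfolding distr_sample[OF assms(2)] by (rule assms(1))
qed

lemma integrable_sample:
  fixes f :: "_ \<Rightarrow> real"
  assumes "integrable P f" "i \<in> {1..n}"
  shows "integrable \<Omega> (\<lambda>\<omega>. f (fst \<omega> i))"
  using integrable_distr[OF measurable_sample[OF assms(2)], of f] assms(1) distr_sample[OF assms(2)]
  by simp

lemma integral_sample:
  fixes f :: "_ \<Rightarrow> real"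
  assumes "f \<in> borel_measurable P" "i \<in> {1..n}"
  shows "(\<integral>\<omega>. f (fst \<omega> i) \<partial>\<Omega>) = (\<integral>p. f p \<partial>P)"
  using integral_distr[OF measurable_sample[OF assms(2)] assms(1)] distr_sample[OF assms(2)] by simp

lemma AE_admissible: "AE \<omega> in \<Omega>. admissible g n (fst \<omega>) (snd \<omega>)"
proof -
  have "AE \<omega> in \<Omega>. \<forall>i\<in>{1..n}. snd (fst \<omega> i) = 0 \<or> snd (fst \<omega> i) = 1"
    using AE_sample[OF AE_data_dist_label[OF pd]] by (intro AE_finite_allI) auto
  then show ?thesis
  proof (rule AE_mp, intro AE_I2 impI)
    fix \<omega> assume \<omega>: "\<omega> \<in> space \<Omega>" "\<forall>i\<in>{1..n}. snd (fst \<omega> i) = 0 \<or> snd (fst \<omega> i) = 1"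
    have "snd \<omega> (i, j) \<in> {0..1}" if "i \<in> {1..n}" "j \<in> {1..n}" for i j
      using measurable_space[OF measurable_coefficient[OF that] \<omega>(1)] by (simp only: space_mixing)
    moreover have "\<forall>z\<in>{0..1}. g z \<in> {0..1}"
      using params unfolding mixup_params_def by blast
    ultimately show "admissible g n (fst \<omega>) (snd \<omega>)"
      using \<omega>(2) unfolding admissible_def by blast
  qed
qed

lemma measurable_data_dist_cong: "f \<in> P \<rightarrow>\<^sub>M L \<longleftrightarrow> f \<in> borel \<Otimes>\<^sub>M borel \<rightarrow>\<^sub>M L"
  by (simp add: measurable_cong_sets[OF sets_data_dist[OF pd] refl])

lemma measurable_mix:
  assumes ij: "i \<in> {1..n}" "j \<in> {1..n}"
  shows "(\<lambda>\<omega>. mix_label (fst \<omega>) (snd \<omega>) i j) \<in> borel_measurable \<Omega>"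
    and "(\<lambda>\<omega>. w \<bullet> mix_point g (fst \<omega>) (snd \<omega>) i j) \<in> borel_measurable \<Omega>"
proof -
  have S[measurable]: "(\<lambda>\<omega>. fst (fst \<omega> k)) \<in> borel_measurable \<Omega>"
    "(\<lambda>\<omega>. snd (fst \<omega> k)) \<in> borel_measurable \<Omega>" if "k \<in> {1..n}" for k
    by (rule measurable_compose[OF measurable_sample[OF that]]; simp add: measurable_data_dist_cong)+
  have lam[measurable]: "(\<lambda>\<omega>. snd \<omega> (i, j)) \<in> borel_measurable \<Omega>"
    by (rule measurable_compose[OF measurable_coefficient[OF ij] measurable_mixing_ident])
  have glam[measurable]: "(\<lambda>\<omega>. g (snd \<omega> (i, j))) \<in> borel_measurable \<Omega>"
    by (rule measurable_compose[OF measurable_coefficient[OF ij] measurable_mixing_g])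
  note [measurable] = S[OF ij(1)] S[OF ij(2)]
  show "(\<lambda>\<omega>. mix_label (fst \<omega>) (snd \<omega>) i j) \<in> borel_measurable \<Omega>"
    unfolding mix_label_def by measurable
  show "(\<lambda>\<omega>. w \<bullet> mix_point g (fst \<omega>) (snd \<omega>) i j) \<in> borel_measurable \<Omega>"
    unfolding mix_point_def by measurable
qed

lemma measurable_loss: "loss w \<in> borel_measurable \<Omega>"
  unfolding mixup_loss_soft_loss soft_loss_eq
  by (intro borel_measurable_times borel_measurable_const borel_measurable_sum borel_measurable_add
      borel_measurable_diff measurable_compose[OF _ borel_measurable_logistic_loss] measurable_mix)

lemma measurable_mixup_slope: "(\<lambda>\<omega>. mixup_slope g n (fst \<omega>) (snd \<omega>) w) \<in> borel_measurable \<Omega>"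
  unfolding mixup_slope_def
  by (intro borel_measurable_times borel_measurable_const borel_measurable_sum
      borel_measurable_diff measurable_mix)

lemma integrable_sample_bound: "integrable \<Omega> (\<lambda>\<omega>. sample_bound n (fst \<omega>))"
proof -
  interpret prob_space \<Omega> by (rule prob_space_mixup_space)
  show ?thesis
    unfolding sample_bound_def
    by (intro Bochner_Integration.integrable_add integrable_const Bochner_Integration.integrable_sum
        integrable_sample integrable_data_dist_norm_sq[OF pd])
qed

lemma integrable_loss: "integrable \<Omega> (loss w)"
proof (rule Bochner_Integration.integrable_bound)
  interpret prob_space \<Omega> by (rule prob_space_mixup_space)
  show "integrable \<Omega> (\<lambda>\<omega>. ln 2 + norm w * sample_bound n (fst \<omega>))"
    by (intro Bochner_Integration.integrable_add integrable_const integrable_mult_right integrable_sample_bound)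
  show "loss w \<in> borel_measurable \<Omega>"
    by (rule measurable_loss)
  show "AE \<omega> in \<Omega>. norm (loss w \<omega>) \<le> norm (ln 2 + norm w * sample_bound n (fst \<omega>))"
    using AE_admissible
  proof eventually_elim
    case (elim \<omega>)
    have "ln 2 > (0 :: real)" by simp
    then show ?case
      using mixup_loss_Lipschitz[OF elim n, of w 0] mixup_loss_0[OF n, of g "fst \<omega>" "snd \<omega>"]
      by (simp only: real_norm_def diff_zero)
  qed
qed

lemma integrable_mixup_slope: "integrable \<Omega> (\<lambda>\<omega>. mixup_slope g n (fst \<omega>) (snd \<omega>) w)"
proof (rule Bochner_Integration.integrable_bound)
  show "integrable \<Omega> (\<lambda>\<omega>. norm w * sample_bound n (fst \<omega>))"
    by (intro integrable_mult_right integrable_sample_bound)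
  show "AE \<omega> in \<Omega>. norm (mixup_slope g n (fst \<omega>) (snd \<omega>) w) \<le> norm (norm w * sample_bound n (fst \<omega>))"
    using AE_admissible
  proof eventually_elim
    case (elim \<omega>)
    then show ?case
      using abs_mixup_slope_le[OF elim n, of w] by (simp only: real_norm_def)
  qed
qed (rule measurable_mixup_slope)

section \<open>Existence and uniqueness of the minimizer\<close>

private abbreviation (input) "L \<equiv> expected_mixup_loss \<mu> \<Sigma> \<Lambda> g n \<kappa>"

lemma expected_mixup_loss_eq: "L w = (\<integral>\<omega>. loss w \<omega> \<partial>\<Omega>)"
  by (simp add: expected_mixup_loss_def case_prod_unfold)

lemma continuous_expected_mixup_loss: "continuous_on UNIV L"
proof -
  define D where "D = (\<integral>\<omega>. sample_bound n (fst \<omega>) \<partial>\<Omega>)"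
  have "\<bar>L v - L w\<bar> \<le> norm (v - w) * D" for v w
  proof -
    have "L v - L w = (\<integral>\<omega>. loss v \<omega> - loss w \<omega> \<partial>\<Omega>)"
      unfolding expected_mixup_loss_eq by (intro Bochner_Integration.integral_diff[symmetric] integrable_loss)
    also have "\<bar>\<dots>\<bar> \<le> (\<integral>\<omega>. \<bar>loss v \<omega> - loss w \<omega>\<bar> \<partial>\<Omega>)"
      by (rule integral_abs_bound)
    also have "\<dots> \<le> (\<integral>\<omega>. norm (v - w) * sample_bound n (fst \<omega>) \<partial>\<Omega>)"
    proof (rule integral_mono_AE)
      show "integrable \<Omega> (\<lambda>\<omega>. \<bar>loss v \<omega> - loss w \<omega>\<bar>)"
        by (intro integrable_abs Bochner_Integration.integrable_diff integrable_loss)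
      show "integrable \<Omega> (\<lambda>\<omega>. norm (v - w) * sample_bound n (fst \<omega>))"
        by (intro integrable_mult_right integrable_sample_bound)
      show "AE \<omega> in \<Omega>. \<bar>loss v \<omega> - loss w \<omega>\<bar> \<le> norm (v - w) * sample_bound n (fst \<omega>)"
        using AE_admissible by eventually_elim (rule mixup_loss_Lipschitz[OF _ n])
    qed
    also have "\<dots> = norm (v - w) * D"
      by (simp add: D_def)
    finally show ?thesis .
  qed
  \<comment> \<open>The bound at a unit vector and 0 puts \<open>D\<close> above an absolute
    value.\<close>
  moreover from this[of "axis undefined 1" 0] have "D \<ge> 0"
    using order_trans[OF abs_ge_zero] by (force simp: norm_axis_1)
  ultimately have "D-lipschitz_on UNIV L"
    by (intro lipschitz_onI) (auto simp: dist_norm dist_real_def mult.commute)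
  then show ?thesis
    by (rule lipschitz_on_continuous_on)
qed

text \<open>Almost surely the first data point separates \<open>v\<close> from \<open>w\<close>, so
  the pointwise inequality is strict almost everywhere and stays strict after integration.\<close>

lemma expected_mixup_loss_midpoint_less:
  assumes "v \<noteq> w"
  shows "2 * L ((1 / 2) *\<^sub>R (v + w)) < L v + L w"
proof -
  interpret prob_space \<Omega> by (rule prob_space_mixup_space)
  have "2 * L ((1 / 2) *\<^sub>R (v + w)) = (\<integral>\<omega>. 2 * loss ((1 / 2) *\<^sub>R (v + w)) \<omega> \<partial>\<Omega>)"
    by (simp add: expected_mixup_loss_eq)
  also have "\<dots> < (\<integral>\<omega>. loss v \<omega> + loss w \<omega> \<partial>\<Omega>)"
  proof (rule integral_less_AE_space)
    show "integrable \<Omega> (\<lambda>\<omega>. 2 * loss ((1 / 2) *\<^sub>R (v + w)) \<omega>)"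
      by (intro integrable_mult_right integrable_loss)
    show "integrable \<Omega> (\<lambda>\<omega>. loss v \<omega> + loss w \<omega>)"
      by (intro Bochner_Integration.integrable_add integrable_loss)
    have "AE \<omega> in \<Omega>. (v - w) \<bullet> fst (fst \<omega> 1) \<noteq> 0"
      by (rule AE_sample) (use assms n in \<open>auto intro: AE_data_dist_inner_neq_0[OF pd]\<close>)
    with AE_admissible show "AE \<omega> in \<Omega>. 2 * loss ((1 / 2) *\<^sub>R (v + w)) \<omega> < loss v \<omega> + loss w \<omega>"
      by eventually_elim (rule mixup_loss_midpoint_less[OF _ n], simp_all add: inner_diff_left)
    show "emeasure \<Omega> (space \<Omega>) \<noteq> 0"
      by (simp add: emeasure_space_1)
  qed
  also have "\<dots> = L v + L w"
    unfolding expected_mixup_loss_eq by (intro Bochner_Integration.integral_add integrable_loss)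
  finally show ?thesis .
qed

text \<open>Unlike the loss it is positively homogeneous in \<open>w\<close>, so its expectation is
  controlled by its values on the unit sphere.\<close>

definition hinge :: "real ^ 'd \<Rightarrow> (real ^ 'd) \<times> real \<Rightarrow> real" where
  "hinge w p = max 0 ((1 - 2 * snd p) * (w \<bullet> fst p))"

lemma integrable_hinge: "integrable P (hinge w)"
proof (rule integrable_data_dist_bound[OF pd])
  show "hinge w \<in> borel_measurable (borel \<Otimes>\<^sub>M borel)"
    unfolding hinge_def[abs_def] by measurable
  fix x :: "real ^ 'd" and y :: real
  assume "y = 0 \<or> y = 1"
  then have "\<bar>hinge w (x, y)\<bar> \<le> \<bar>w \<bullet> x\<bar>"
    by (auto simp: hinge_def)
  also have "\<dots> \<le> norm w * norm x"
    by (rule Cauchy_Schwarz_ineq2)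
  also have "norm x \<le> 1 + (norm x)\<^sup>2"
    by (rule le_one_plus_square)
  finally show "\<bar>hinge w (x, y)\<bar> \<le> norm w * (1 + (norm x)\<^sup>2)"
    by (simp add: mult_left_mono)
qed

text \<open>At label 1 the hinge is the positive part of \<open>- (w \<bullet> x)\<close>. If its
  expectation vanished, the Gaussian of that class would live on a half-space.\<close>

lemma expected_hinge_pos:
  assumes "w \<noteq> 0"
  shows "(\<integral>p. hinge w p \<partial>P) > 0"
proof -
  have nonneg: "hinge w p \<ge> 0" for p
    by (simp add: hinge_def)
  have "(\<integral>p. hinge w p \<partial>P) \<noteq> 0"
  proof
    assume "(\<integral>p. hinge w p \<partial>P) = 0"
    then have "AE p in P. hinge w p = 0"
      using integral_nonneg_eq_0_iff_AE[OF integrable_hinge[of w]] nonneg by simp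
    moreover have "Measurable.pred (borel \<Otimes>\<^sub>M borel) (\<lambda>p. hinge w p = 0)"
      unfolding hinge_def by measurable
    ultimately have "AE x in gaussian \<mu> (inverse \<kappa> *\<^sub>R \<Sigma>). hinge w (x, 1) = 0"
      using AE_data_dist[OF pd] by blast
    then have "AE x in gaussian \<mu> (inverse \<kappa> *\<^sub>R \<Sigma>). w \<bullet> x \<ge> 0"
      by eventually_elim (auto simp: hinge_def max_def split: if_splits)
    then show False
      using not_AE_gaussian_inner_nonneg[OF pd assms] by blast
  qed
  moreover have "(\<integral>p. hinge w p \<partial>P) \<ge> 0"
    by (intro Bochner_Integration.integral_nonneg nonneg)
  ultimately show ?thesis by simp
qed

text \<open>The expected hinge \<open>K\<close> is continuous and positive on the compact unit
  sphere, so it has a positive minimum \<open>K w0\<close> there, and homogeneity turns this into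
  growth at rate \<open>K w0\<close>. The factor \<open>1 / (real n)\<^sup>2\<close> is the weight
  of one summand in the loss.\<close>

lemma expected_mixup_loss_coercive: "\<exists>\<delta>>0. \<forall>w. \<delta> * norm w \<le> L w"
proof -
  define K where "K w = (\<integral>p. hinge w p \<partial>P)" for w
  define E where "E = (\<integral>p. 1 + (norm (fst p))\<^sup>2 \<partial>P)"
  interpret P: prob_space P by (rule prob_space_data_dist[OF pd])
  have intE: "integrable P (\<lambda>p. 1 + (norm (fst p))\<^sup>2)"
    by (intro Bochner_Integration.integrable_add P.integrable_const integrable_data_dist_norm_sq[OF pd])
  have "\<bar>K v - K w\<bar> \<le> norm (v - w) * E" for v w
  proof -
    have "K v - K w = (\<integral>p. hinge v p - hinge w p \<partial>P)"
      unfolding K_def by (intro Bochner_Integration.integral_diff[symmetric] integrable_hinge)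
    also have "\<bar>\<dots>\<bar> \<le> (\<integral>p. \<bar>hinge v p - hinge w p\<bar> \<partial>P)"
      by (rule integral_abs_bound)
    also have "\<dots> \<le> (\<integral>p. norm (v - w) * (1 + (norm (fst p))\<^sup>2) \<partial>P)"
    proof (rule integral_mono_AE)
      show "integrable P (\<lambda>p. \<bar>hinge v p - hinge w p\<bar>)"
        by (intro integrable_abs Bochner_Integration.integrable_diff integrable_hinge)
      show "integrable P (\<lambda>p. norm (v - w) * (1 + (norm (fst p))\<^sup>2))"
        by (intro integrable_mult_right intE)
      show "AE p in P. \<bar>hinge v p - hinge w p\<bar> \<le> norm (v - w) * (1 + (norm (fst p))\<^sup>2)"
        using AE_data_dist_label[OF pd]
      proof eventually_elim
        case (elim p)
        then have "\<bar>hinge v p - hinge w p\<bar> \<le> \<bar>(v - w) \<bullet> fst p\<bar>"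
          by (auto simp: hinge_def inner_diff_left max_def)
        also have "\<dots> \<le> norm (v - w) * norm (fst p)"
          by (rule Cauchy_Schwarz_ineq2)
        also have "norm (fst p) \<le> 1 + (norm (fst p))\<^sup>2"
          by (rule le_one_plus_square)
        finally show ?case
          by (simp add: mult_left_mono)
      qed
    qed
    also have "\<dots> = norm (v - w) * E"
      by (simp add: E_def)
    finally show ?thesis .
  qed
  moreover have "E \<ge> 0"
    unfolding E_def by (intro Bochner_Integration.integral_nonneg) simp
  ultimately have "E-lipschitz_on UNIV K"
    by (intro lipschitz_onI) (auto simp: dist_norm dist_real_def mult.commute)
  then have contK: "continuous_on UNIV K"
    by (rule lipschitz_on_continuous_on)
  have "axis undefined 1 \<in> sphere (0 :: real ^ 'd) 1"
    by (simp add: norm_axis_1)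
  then have "\<exists>w\<in>sphere (0 :: real ^ 'd) 1. \<forall>v\<in>sphere 0 1. K w \<le> K v"
    by (intro continuous_attains_inf continuous_on_subset[OF contK]) auto
  then obtain w0 :: "real ^ 'd" where w0: "norm w0 = 1" "\<And>v. norm v = 1 \<Longrightarrow> K w0 \<le> K v"
    by auto
  have "K w0 > 0"
    unfolding K_def using w0(1) by (intro expected_hinge_pos) auto
  have K: "K w0 * norm w \<le> K w" for w
  proof (cases "w = 0")
    case True
    then show ?thesis by (simp add: K_def hinge_def)
  next
    case False
    have "hinge w p = norm w * hinge ((1 / norm w) *\<^sub>R w) p" for p
      using False by (simp add: hinge_def max_mult_distrib_left)
    then have "K w = norm w * K ((1 / norm w) *\<^sub>R w)"
      by (simp add: K_def)
    moreover have "K w0 \<le> K ((1 / norm w) *\<^sub>R w)"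
      using False by (intro w0(2)) simp
    ultimately show ?thesis
      by (simp only: mult.commute[of "K w0"]) (simp add: mult_left_mono)
  qed
  have "1 / (real n)\<^sup>2 * K w \<le> L w" for w
  proof -
    have one: "1 \<in> {1..n}" using n by simp
    have "1 / (real n)\<^sup>2 * K w = (\<integral>\<omega>. 1 / (real n)\<^sup>2 * hinge w (fst \<omega> 1) \<partial>\<Omega>)"
      unfolding K_def using integral_sample[OF borel_measurable_integrable[OF integrable_hinge] one, of w]
      by simp
    also have "\<dots> \<le> L w"
      unfolding expected_mixup_loss_eq
    proof (rule integral_mono_AE)
      show "integrable \<Omega> (\<lambda>\<omega>. 1 / (real n)\<^sup>2 * hinge w (fst \<omega> 1))"
        by (intro integrable_mult_right integrable_sample integrable_hinge one)
      show "integrable \<Omega> (loss w)"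
        by (rule integrable_loss)
      show "AE \<omega> in \<Omega>. 1 / (real n)\<^sup>2 * hinge w (fst \<omega> 1) \<le> loss w \<omega>"
        using AE_admissible unfolding hinge_def by eventually_elim (rule mixup_loss_ge_hinge[OF _ n])
    qed
    finally show ?thesis .
  qed
  then have "1 / (real n)\<^sup>2 * K w0 * norm w \<le> L w" for w
    using order_trans[OF mult_left_mono[OF K[of w], of "1 / (real n)\<^sup>2"]] by (simp add: mult.assoc)
  moreover have "1 / (real n)\<^sup>2 * K w0 > 0"
    using \<open>K w0 > 0\<close> n by simp
  ultimately show ?thesis by blast
qed

lemma ex1_minimizer_expected_mixup_loss: "\<exists>!w. is_arg_min L (\<lambda>_. True) w"
  using expected_mixup_loss_coercive
    ex1_minimizer[OF continuous_expected_mixup_loss _ _ expected_mixup_loss_midpoint_less] by blast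

text \<open>Applying \<open>M\<close> to every sample point and leaving the coefficients alone
  preserves the joint law, factor by factor; the change of variables then shifts \<open>M\<close>
  onto \<open>w\<close>.\<close>

lemma expected_mixup_loss_linear_invariant:
  fixes M :: "real ^ 'd ^ 'd"
  assumes M: "invertible M" "M *v \<mu> = \<mu>" "M ** (inverse \<kappa> *\<^sub>R \<Sigma>) ** transpose M = inverse \<kappa> *\<^sub>R \<Sigma>"
  shows "L (transpose M *v w) = L w"
proof -
  let ?m = "\<lambda>p :: (real ^ 'd) \<times> real. (M *v fst p, snd p)"
  let ?h = "\<lambda>(S, lam). (compose {1..n} ?m S, lam)"
  have m: "?m \<in> P \<rightarrow>\<^sub>M P"
    by (subst measurable_cong_sets[OF sets_data_dist[OF pd] sets_data_dist[OF pd]]) measurable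
  have distrP: "distr P P ?m = P"
  proof -
    have "distr P P ?m = distr P (borel \<Otimes>\<^sub>M borel) ?m"
      by (rule distr_cong) (simp_all add: sets_data_dist[OF pd])
    also have "\<dots> = P"
      by (rule data_dist_linear[OF pd M])
    finally show ?thesis .
  qed
  have distrPS: "distr PS PS (compose {1..n} ?m) = PS"
    by (subst distr_PiM_finite_prob_space') (simp_all add: prob_space_data_dist[OF pd] m distrP)
  have comp: "compose {1..n} ?m \<in> PS \<rightarrow>\<^sub>M PS"
    unfolding compose_def
    by (rule measurable_restrict, rule measurable_compose[OF _ m], rule measurable_component_singleton)
  have "distr \<Omega> \<Omega> ?h = distr PS PS (compose {1..n} ?m) \<Otimes>\<^sub>M distr P\<Lambda> P\<Lambda> (\<lambda>x. x)"
    unfolding mixup_space_def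
    by (rule pair_measure_distr[symmetric, OF comp])
      (use prob_space_imp_sigma_finite[OF prob_space_coefficients] in simp_all)
  then have distr\<Omega>: "distr \<Omega> \<Omega> ?h = \<Omega>"
    by (simp only: distrPS distr_id2 mixup_space_def)
  have h: "?h \<in> \<Omega> \<rightarrow>\<^sub>M \<Omega>"
    unfolding mixup_space_def using comp by measurable
  have "L w = (\<integral>\<omega>. loss w \<omega> \<partial>distr \<Omega> \<Omega> ?h)"
    unfolding distr\<Omega> expected_mixup_loss_eq ..
  also have "\<dots> = (\<integral>\<omega>. loss w (?h \<omega>) \<partial>\<Omega>)"
    by (rule integral_distr[OF h measurable_loss])
  also have "\<dots> = L (transpose M *v w)"
    unfolding expected_mixup_loss_eq by (simp only: case_prod_unfold fst_conv snd_conv mixup_loss_linear_image)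
  finally show ?thesis ..
qed

section \<open>Moments of labels and points, and the sign of the minimizer\<close>

lemma integrable_data_moments:
  "integrable P (\<lambda>p. 2 * snd p - 1)" "integrable P (\<lambda>p. u \<bullet> fst p)"
  "integrable P (\<lambda>p. (2 * snd p - 1) * (u \<bullet> fst p))"
proof -
  have ux: "\<bar>u \<bullet> x\<bar> \<le> norm u * (1 + (norm x)\<^sup>2)" for x
  proof -
    have "norm x \<le> 1 + (norm x)\<^sup>2"
      by (rule le_one_plus_square)
    then have "norm u * norm x \<le> norm u * (1 + (norm x)\<^sup>2)"
      by (rule mult_left_mono) simp
    then show ?thesis
      using Cauchy_Schwarz_ineq2[of u x] by linarith
  qed
  show "integrable P (\<lambda>p. 2 * snd p - 1)"
    by (rule integrable_data_dist_bound[OF pd, where C = 1]) auto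
  show "integrable P (\<lambda>p. u \<bullet> fst p)"
    by (rule integrable_data_dist_bound[OF pd, where C = "norm u"]) (simp_all add: ux)
  show "integrable P (\<lambda>p. (2 * snd p - 1) * (u \<bullet> fst p))"
    by (rule integrable_data_dist_bound[OF pd, where C = "norm u"]) (use ux in auto)
qed

text \<open>\<open>2 * snd p - 1\<close> is the label as a sign. It is centred because the classes
  are balanced, and multiplying a point by it gives mean \<mu> in both classes.\<close>

lemma integral_data_moments:
  "(\<integral>p. 2 * snd p - 1 \<partial>P) = 0"
  "(\<integral>p. (2 * snd p - 1) * (u \<bullet> fst p) \<partial>P) = u \<bullet> \<mu>"
proof -
  have "measure (gaussian m (inverse \<kappa> *\<^sub>R \<Sigma>)) UNIV = 1" for m :: "real ^ 'd"
    using prob_space.prob_space[OF prob_space_gaussian[OF pd, of m]] by simp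
  then show "(\<integral>p. 2 * snd p - 1 \<partial>P) = 0"
    by (subst integral_data_dist[OF pd integrable_data_moments(1)]) simp
  show "(\<integral>p. (2 * snd p - 1) * (u \<bullet> fst p) \<partial>P) = u \<bullet> \<mu>"
    by (subst integral_data_dist[OF pd integrable_data_moments(3)])
      (simp add: integral_gaussian_inner[OF pd])
qed

text \<open>For distinct samples independence factors the expectation, and the centred sign makes it
  vanish.\<close>

lemma label_point_moment:
  assumes ij: "i \<in> {1..n}" "j \<in> {1..n}"
  shows "integrable PS (\<lambda>S. (2 * snd (S i) - 1) * (u \<bullet> fst (S j)))"
    and "(\<integral>S. (2 * snd (S i) - 1) * (u \<bullet> fst (S j)) \<partial>PS) = (if i = j then u \<bullet> \<mu> else 0)"
proof -
  interpret product_sigma_finite "\<lambda>_ :: nat. P"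
    by (intro product_sigma_finite.intro prob_space_imp_sigma_finite prob_space_data_dist[OF pd])
  interpret P: prob_space P by (rule prob_space_data_dist[OF pd])
  \<comment> \<open>Label factor at \<open>i\<close>, point factor at \<open>j\<close>, 1 elsewhere:
    one product over all coordinates covers both cases.\<close>
  define f where "f k p = (if k = i then 2 * snd p - 1 else 1) * (if k = j then u \<bullet> fst p else 1)"
    for k and p :: "(real ^ 'd) \<times> real"
  have f: "integrable P (f k)" for k
    using integrable_data_moments(1) integrable_data_moments(2,3)[of u] by (cases "k = i"; cases "k = j") (simp_all add: f_def[abs_def])
  have prod: "(\<lambda>S. (2 * snd (S i) - 1) * (u \<bullet> fst (S j))) = (\<lambda>S. \<Prod>k\<in>{1..n}. f k (S k))"
    using ij by (simp add: f_def prod.distrib prod.delta)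
  show "integrable PS (\<lambda>S. (2 * snd (S i) - 1) * (u \<bullet> fst (S j)))"
    unfolding prod by (rule product_integrable_prod) (simp_all add: f)
  have "(\<integral>S. (2 * snd (S i) - 1) * (u \<bullet> fst (S j)) \<partial>PS) = (\<Prod>k\<in>{1..n}. \<integral>p. f k p \<partial>P)"
    unfolding prod by (rule product_integral_prod) (simp_all add: f)
  also have "\<dots> = (if i = j then u \<bullet> \<mu> else 0)"
  proof (cases "i = j")
    case True
    have "(\<integral>p. f k p \<partial>P) = (if k = i then u \<bullet> \<mu> else 1)" for k
      using integral_data_moments(2)[of u] True by (simp add: f_def P.prob_space)
    then show ?thesis
      using True ij by (simp add: prod.delta)
  next
    case False
    have "(\<integral>p. f i p \<partial>P) = 0"
      using integral_data_moments(1) False by (simp add: f_def)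
    then have "(\<Prod>k\<in>{1..n}. \<integral>p. f k p \<partial>P) = 0"
      using ij by (intro prod_zero) auto
    then show ?thesis using False by simp
  qed
  finally show "(\<integral>S. (2 * snd (S i) - 1) * (u \<bullet> fst (S j)) \<partial>PS) = (if i = j then u \<bullet> \<mu> else 0)" .
qed

text \<open>The centred label is half the mixture of the two signs, so the product expands into four
  sign-point terms. For \<open>i \<noteq> j\<close> only the terms pairing a point with its own sign
  survive, with weights \<open>a * c\<close> and \<open>(1 - a) * (1 - c)\<close>; for
  \<open>i = j\<close> all four weights add up to 1.\<close>

lemma integral_mix_label_point:
  fixes lam :: "nat \<times> nat \<Rightarrow> real"
  assumes ij: "i \<in> {1..n}" "j \<in> {1..n}"
  defines "a \<equiv> lam (i, j)" and "c \<equiv> g (lam (i, j))"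
  shows "integrable PS (\<lambda>S. (mix_label S lam i j - 1 / 2) * (u \<bullet> mix_point g S lam i j))"
    and "(\<integral>S. (mix_label S lam i j - 1 / 2) * (u \<bullet> mix_point g S lam i j) \<partial>PS) =
      (if i = j then 1 else a * c + (1 - a) * (1 - c)) * (u \<bullet> \<mu>) / 2"
proof -
  let ?m = "\<lambda>k l S. (2 * snd (S k) - 1) * (u \<bullet> fst (S l))"
  let ?F = "\<lambda>S. (a * c / 2) * ?m i i S + (a * (1 - c) / 2) * ?m i j S +
      (((1 - a) * c / 2) * ?m j i S + ((1 - a) * (1 - c) / 2) * ?m j j S)"
  have "u \<bullet> mix_point g S lam i j = c * (u \<bullet> fst (S i)) + (1 - c) * (u \<bullet> fst (S j))" for S
    by (simp add: mix_point_def c_def inner_add_right)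
  then have eq: "(\<lambda>S. (mix_label S lam i j - 1 / 2) * (u \<bullet> mix_point g S lam i j)) = ?F"
    by (simp add: fun_eq_iff mix_label_def flip: a_def) (simp add: field_simps)
  have int: "integrable PS (\<lambda>S. b * ?m k l S)" if "k \<in> {1..n}" "l \<in> {1..n}" for k l b
    by (intro integrable_mult_right label_point_moment that)
  show "integrable PS (\<lambda>S. (mix_label S lam i j - 1 / 2) * (u \<bullet> mix_point g S lam i j))"
    unfolding eq by (intro Bochner_Integration.integrable_add int ij)
  have mom: "(\<integral>S. b * ?m k l S \<partial>PS) = b * (if k = l then u \<bullet> \<mu> else 0)"
    if "k \<in> {1..n}" "l \<in> {1..n}" for k l b
    by (simp only: integral_mult_right_zero label_point_moment(2)[OF that])
  have "(\<integral>S. ?F S \<partial>PS) =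
      (a * c / 2) * (u \<bullet> \<mu>) + (a * (1 - c) / 2) * (if i = j then u \<bullet> \<mu> else 0) +
      (((1 - a) * c / 2) * (if j = i then u \<bullet> \<mu> else 0) + ((1 - a) * (1 - c) / 2) * (u \<bullet> \<mu>))"
    by (simp only: Bochner_Integration.integral_add Bochner_Integration.integrable_add int ij mom simp_thms if_True)
  then show "(\<integral>S. (mix_label S lam i j - 1 / 2) * (u \<bullet> mix_point g S lam i j) \<partial>PS) =
      (if i = j then 1 else a * c + (1 - a) * (1 - c)) * (u \<bullet> \<mu>) / 2"
    unfolding eq by (auto simp: field_simps)
qed

text \<open>For fixed coefficients every summand has nonnegative mean and the first diagonal one has
  mean \<open>(u \<bullet> \<mu>) / 2\<close>. This lower bound is the same for all
  \<open>lam\<close>, so it survives the outer integral of Fubini.\<close>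

lemma expected_mixup_slope_pos:
  assumes u: "u \<bullet> \<mu> > 0"
  shows "(\<integral>\<omega>. mixup_slope g n (fst \<omega>) (snd \<omega>) u \<partial>\<Omega>) > 0"
proof -
  interpret PS: prob_space PS by (rule prob_space_samples)
  interpret PL: prob_space P\<Lambda> by (rule prob_space_coefficients)
  interpret pair_sigma_finite PS P\<Lambda> ..
  have int: "integrable (PS \<Otimes>\<^sub>M P\<Lambda>) (\<lambda>(S, lam). mixup_slope g n S lam u)"
    using integrable_mixup_slope[of u] by (simp add: mixup_space_def case_prod_unfold)
  have inner: "1 / (real n)\<^sup>2 * ((u \<bullet> \<mu>) / 2) \<le> (\<integral>S. mixup_slope g n S lam u \<partial>PS)"
    if lam: "lam \<in> space P\<Lambda>" for lam
  proof -
    define q where "q i j = (\<integral>S. (mix_label S lam i j - 1 / 2) * (u \<bullet> mix_point g S lam i j) \<partial>PS)" for i j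
    have q: "q i j \<ge> 0" if ij: "i \<in> {1..n}" "j \<in> {1..n}" for i j
    proof -
      have "lam (i, j) \<in> {0..1}"
        using lam ij unfolding space_PiM space_mixing by (auto simp: PiE_iff)
      moreover from this have "g (lam (i, j)) \<in> {0..1}"
        using params unfolding mixup_params_def by blast
      ultimately show ?thesis
        unfolding q_def integral_mix_label_point(2)[OF ij] using u by (auto intro!: mult_nonneg_nonneg add_nonneg_nonneg)
    qed
    have one: "1 \<in> {1..n}" using n by simp
    have "(u \<bullet> \<mu>) / 2 = q 1 1"
      unfolding q_def integral_mix_label_point(2)[OF one one] by simp
    also have "\<dots> \<le> (\<Sum>j = 1..n. q 1 j)"
      using one q by (intro member_le_sum) auto
    also have "\<dots> \<le> (\<Sum>i = 1..n. \<Sum>j = 1..n. q i j)"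
      using one q by (intro member_le_sum[of 1 _ "\<lambda>i. \<Sum>j = 1..n. q i j"] sum_nonneg) auto
    finally have "1 / (real n)\<^sup>2 * ((u \<bullet> \<mu>) / 2) \<le> 1 / (real n)\<^sup>2 * (\<Sum>i = 1..n. \<Sum>j = 1..n. q i j)"
      by (rule mult_left_mono) simp
    also have "(\<Sum>i = 1..n. \<Sum>j = 1..n. q i j) =
        (\<Sum>i = 1..n. \<integral>S. (\<Sum>j = 1..n. (mix_label S lam i j - 1 / 2) * (u \<bullet> mix_point g S lam i j)) \<partial>PS)"
      unfolding q_def
      by (intro sum.cong refl Bochner_Integration.integral_sum[symmetric] integral_mix_label_point)
    also have "\<dots> =
        (\<integral>S. (\<Sum>i = 1..n. \<Sum>j = 1..n. (mix_label S lam i j - 1 / 2) * (u \<bullet> mix_point g S lam i j)) \<partial>PS)"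
      by (intro Bochner_Integration.integral_sum[symmetric] Bochner_Integration.integrable_sum integral_mix_label_point)
    finally show ?thesis
      by (simp add: mixup_slope_def)
  qed
  have "0 < 1 / (real n)\<^sup>2 * ((u \<bullet> \<mu>) / 2)"
    using u n by simp
  also have "\<dots> \<le> (\<integral>lam. (\<integral>S. mixup_slope g n S lam u \<partial>PS) \<partial>P\<Lambda>)"
    using inner by (intro PL.integral_ge_const integrable_snd[OF int] AE_I2)
  also have "\<dots> = (\<integral>\<omega>. mixup_slope g n (fst \<omega>) (snd \<omega>) u \<partial>\<Omega>)"
    using integral_snd[OF int] by (simp add: mixup_space_def case_prod_unfold)
  finally show ?thesis .
qed

lemma minimizer_coefficient_pos:
  assumes u: "u \<bullet> \<mu> > 0" and min: "\<And>v. L (c *\<^sub>R u) \<le> L v"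
  shows "c > 0"
proof -
  interpret prob_space \<Omega> by (rule prob_space_mixup_space)
  define s where "s = (\<integral>\<omega>. mixup_slope g n (fst \<omega>) (snd \<omega>) u \<partial>\<Omega>)"
  have "s > 0"
    unfolding s_def by (rule expected_mixup_slope_pos[OF u])
  have slope: "(\<integral>\<omega>. mixup_slope g n (fst \<omega>) (snd \<omega>) (t *\<^sub>R u) \<partial>\<Omega>) = t * s" for t
    by (simp add: s_def mixup_slope_scaleR)
  have lower: "ln 2 - t * s \<le> L (t *\<^sub>R u)" for t
  proof -
    have "ln 2 - t * s = (\<integral>\<omega>. ln 2 - mixup_slope g n (fst \<omega>) (snd \<omega>) (t *\<^sub>R u) \<partial>\<Omega>)"
      using integrable_mixup_slope[of "t *\<^sub>R u"] by (simp add: slope prob_space)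
    also have "\<dots> \<le> L (t *\<^sub>R u)"
      unfolding expected_mixup_loss_eq
    proof (rule integral_mono_AE)
      show "integrable \<Omega> (\<lambda>\<omega>. ln 2 - mixup_slope g n (fst \<omega>) (snd \<omega>) (t *\<^sub>R u))"
        by (intro Bochner_Integration.integrable_diff integrable_const integrable_mixup_slope)
      show "AE \<omega> in \<Omega>. ln 2 - mixup_slope g n (fst \<omega>) (snd \<omega>) (t *\<^sub>R u) \<le> loss (t *\<^sub>R u) \<omega>"
        using AE_admissible by eventually_elim (rule mixup_loss_ge_slope[OF _ n])
    qed (rule integrable_loss)
    finally show ?thesis .
  qed
  define A where "A = (norm u)\<^sup>2 * (\<integral>\<omega>. sample_bound n (fst \<omega>) \<partial>\<Omega>) / 8"
  have "A \<ge> 0"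
    unfolding A_def sample_bound_def
    by (intro divide_nonneg_pos mult_nonneg_nonneg Bochner_Integration.integral_nonneg add_nonneg_nonneg sum_nonneg) auto
  have upper: "L (t *\<^sub>R u) \<le> ln 2 + t\<^sup>2 * A - t * s" for t
  proof -
    let ?B = "\<lambda>\<omega>. ln 2 + (norm (t *\<^sub>R u))\<^sup>2 / 8 * sample_bound n (fst \<omega>) -
        mixup_slope g n (fst \<omega>) (snd \<omega>) (t *\<^sub>R u)"
    have "L (t *\<^sub>R u) \<le> (\<integral>\<omega>. ?B \<omega> \<partial>\<Omega>)"
      unfolding expected_mixup_loss_eq
    proof (rule integral_mono_AE)
      show "integrable \<Omega> ?B"
        by (intro Bochner_Integration.integrable_diff Bochner_Integration.integrable_add integrable_const
            integrable_mult_right integrable_sample_bound integrable_mixup_slope)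
      show "AE \<omega> in \<Omega>. loss (t *\<^sub>R u) \<omega> \<le> ?B \<omega>"
        using AE_admissible
      proof eventually_elim
        case (elim \<omega>)
        show ?case using mixup_loss_le_slope[OF elim n, of "t *\<^sub>R u"] by simp
      qed
    qed (rule integrable_loss)
    also have "\<dots> = ln 2 + t\<^sup>2 * A - t * s"
      using integrable_mixup_slope[of "t *\<^sub>R u"] integrable_sample_bound
      by (simp add: slope prob_space A_def power_mult_distrib)
    finally show ?thesis .
  qed
  \<comment> \<open>Any positive \<open>t\<close> with \<open>t * A < s\<close> lets the linear gain
    beat the quadratic cost; the added 1 keeps the quotient meaningful when \<open>A\<close> is
    0.\<close>
  define t where "t = s / (A + 1)"
  have "t > 0" and "t * A < s"
    using \<open>s > 0\<close> \<open>A \<ge> 0\<close> by (simp_all add: t_def field_simps)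
  then have "t * (t * A) < t * s"
    by simp
  then have "L (t *\<^sub>R u) < ln 2"
    using upper[of t] by (simp add: power2_eq_square mult.assoc)
  then have "ln 2 - c * s < ln 2"
    using lower[of c] min[of "t *\<^sub>R u"] by linarith
  then show ?thesis
    using \<open>s > 0\<close> by (simp add: zero_less_mult_iff)
qed

end

theorem theorem4p2:
  fixes \<mu> :: "real ^ 'd" and \<Sigma> :: "real ^ 'd ^ 'd"
    and \<Lambda> :: "real measure" and g :: "real \<Rightarrow> real"
    and \<kappa> :: real and n :: nat
  assumes "\<mu> \<noteq> 0"
    and "positive_definite \<Sigma>"
    and "(norm \<mu>)\<^sup>2 = spectral_norm \<Sigma>"
    and "mixup_params \<Lambda> g"
    and "\<kappa> > 0"
    and "n \<ge> 2"
  shows "(\<exists>!w. is_arg_min (expected_mixup_loss \<mu> \<Sigma> \<Lambda> g n \<kappa>) (\<lambda>_. True) w) \<and>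
    (\<forall>w. is_arg_min (expected_mixup_loss \<mu> \<Sigma> \<Lambda> g n \<kappa>) (\<lambda>_. True) w \<longrightarrow>
       (\<exists>c>0. w = c *\<^sub>R (matrix_inv \<Sigma> *v \<mu>)))"
proof -
  let ?L = "expected_mixup_loss \<mu> \<Sigma> \<Lambda> g n \<kappa>"
  have n: "n \<ge> 1" using assms(6) by simp
  have pd: "positive_definite (inverse \<kappa> *\<^sub>R \<Sigma>)"
    using assms(2,5) by (simp add: positive_definite_scaleR)
  note ex1 = ex1_minimizer_expected_mixup_loss[OF pd assms(4) n]
  define u where "u = matrix_inv \<Sigma> *v \<mu>"
  have "det \<Sigma> \<noteq> 0"
    using det_positive_definite_pos[OF assms(2)] by simp
  then obtain C where C: "\<Sigma> ** C = mat 1" "C ** \<Sigma> = mat 1"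
    using invertible_det_nz[of \<Sigma>] unfolding invertible_def by blast
  have \<Sigma>u: "\<Sigma> *v u = \<mu>"
    unfolding u_def matrix_inv_eqI[OF C] by (simp add: matrix_vector_mul_assoc C)
  have "u \<noteq> 0" using \<Sigma>u assms(1) by auto
  then have u\<mu>: "u \<bullet> \<mu> > 0"
    using assms(2) unfolding positive_definite_def by (metis \<Sigma>u)
  \<comment> \<open>The reflection is taken for the covariance of the data,
    \<open>inverse \<kappa> *\<^sub>R \<Sigma>\<close>, so its axis comes as
    \<open>\<kappa> *\<^sub>R u\<close>, on the same line as \<open>u\<close>.\<close>
  have "(inverse \<kappa> *\<^sub>R \<Sigma>) *v (\<kappa> *\<^sub>R u) = \<mu>"
    using assms(5) by (simp add: scaleR_matrix_vector_assoc[symmetric] matrix_vector_mult_scaleR \<Sigma>u)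
  from positive_definite_reflection[OF pd this assms(1)]
  obtain M where M: "invertible M" "M *v \<mu> = \<mu>"
      "M ** (inverse \<kappa> *\<^sub>R \<Sigma>) ** transpose M = inverse \<kappa> *\<^sub>R \<Sigma>"
    and T: "\<And>w. transpose M *v w = (2 * (w \<bullet> \<mu>) / ((\<kappa> *\<^sub>R u) \<bullet> \<mu>)) *\<^sub>R (\<kappa> *\<^sub>R u) - w"
    by metis
  have "\<exists>c>0. w = c *\<^sub>R u" if w: "is_arg_min ?L (\<lambda>_. True) w" for w
  proof -
    have "?L (transpose M *v w) = ?L w"
      by (rule expected_mixup_loss_linear_invariant[OF pd assms(4) n M])
    then have "is_arg_min ?L (\<lambda>_. True) (transpose M *v w)"
      using w by (simp add: is_arg_min_linorder)
    then have "transpose M *v w = w"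
      using ex1 w by blast
    \<comment> \<open>The formula \<open>T\<close> has the shape \<open>s - w\<close> with
      \<open>s\<close> on the line of \<open>u\<close>, so a fixed vector satisfies
      \<open>2 *\<^sub>R w = s\<close>.\<close>
    then have "2 *\<^sub>R w = (2 * (w \<bullet> \<mu>) / ((\<kappa> *\<^sub>R u) \<bullet> \<mu>)) *\<^sub>R (\<kappa> *\<^sub>R u)"
      unfolding T by (simp add: scaleR_2 algebra_simps)
    then have "(1 / 2) *\<^sub>R (2 *\<^sub>R w) = (1 / 2) *\<^sub>R ((2 * (w \<bullet> \<mu>) / ((\<kappa> *\<^sub>R u) \<bullet> \<mu>)) *\<^sub>R (\<kappa> *\<^sub>R u))"
      by (rule arg_cong)
    then obtain c where c: "w = c *\<^sub>R u"
      by auto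
    have "c > 0"
      using w by (intro minimizer_coefficient_pos[OF pd assms(4) n u\<mu>]) (simp add: c is_arg_min_linorder)
    with c show ?thesis by blast
  qed
  with ex1 show ?thesis
    unfolding u_def by blast
qed

end
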